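(* Let $m \geq 3$ and $n \geq 3$ be relatively prime integers. If $m = 3$ or $m$ is even, then the determinant of the Turk's Head knot $THK(m,n)$ is composite.
   Context: For integers $m,n \geq 2$, the Turk's Head link $THK(m,n)$ is the link obtained by taking the standard braid representation of the $(m,n)$ torus link on $m$ strands and making it alternating; that is, it is the closure of the $m$-strand braid $\left(\sigma_1 \sigma_2^{-1} \sigma_3 \sigma_4^{-1} \cdots \sigma_{m-1}^{\pm 1}\right)^n$, where $\sigma_i$ are the standard braid generators and the exponent of $\sigma_i$ in each block is $+1$ for $i$ odd and $-1$ for $i$ even. It has $\gcd(m,n)$ components, so it is a knot exactly when $m$ and $n$ are relatively prime. The determinant is the usual knot determinant ($|\Delta(-1)|$ with $\Delta$ the Alexander polynomial); for an alternating diagram it equals the number of spanning trees of a checkerboard graph of the diagram. *)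

theory Defs
  imports
    "HOL-Computational_Algebra.Polynomial"
    "HOL-Computational_Algebra.Primes"
    "Jordan_Normal_Form.Determinant"
begin

text \<open>
  A braid word on \<open>m\<close> strands is a list of nonzero integers of absolute value less than \<open>m\<close>:
  \<open>i > 0\<close> stands for \<open>\<sigma>\<^sub>i\<close> and \<open>- i\<close> for its inverse. The braid is drawn downwards with all strands
  oriented downwards, and in \<open>\<sigma>\<^sub>i\<close> the strand in position \<open>i\<close> passes over the strand in position
  \<open>i + 1\<close>. Exchanging over and under yields the mirror image, which has the same determinant.
\<close>

text \<open>
  \<open>left\<close> and \<open>right\<close> are the under-arcs to the left and to the right of the oriented over-arc.
\<close>

datatype crossing = Crossing (over: nat) (left: nat) (right: nat)

text \<open>
  The list \<open>as\<close> contains the arcs that occupy positions \<open>1, 2, \<dots>\<close> (list indices \<open>0, 1, \<dots>\<close>) above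
  the remaining part of the word. At each crossing the strand passing under ends its arc and
  begins the new arc with label \<open>k\<close>; in \<open>\<sigma>\<^sub>i\<close> the incoming under-arc lies to the left of the
  over-arc, in the inverse of \<open>\<sigma>\<^sub>i\<close> it lies to the right.
\<close>

fun crossings_from :: "nat list \<Rightarrow> nat \<Rightarrow> int list \<Rightarrow> crossing list" where
  "crossings_from as k [] = []"
| "crossings_from as k (g # gs) =
    (let i = nat \<bar>g\<bar>; x = as ! (i - 1); y = as ! i in
     if g > 0 then Crossing x y k # crossings_from (as[i - 1 := k, i := x]) (Suc k) gs
     else Crossing y k x # crossings_from (as[i - 1 := y, i := k]) (Suc k) gs)"

fun bottom_arcs_from :: "nat list \<Rightarrow> nat \<Rightarrow> int list \<Rightarrow> nat list" where
  "bottom_arcs_from as k [] = as"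
| "bottom_arcs_from as k (g # gs) =
    (let i = nat \<bar>g\<bar>; x = as ! (i - 1); y = as ! i in
     if g > 0 then bottom_arcs_from (as[i - 1 := k, i := x]) (Suc k) gs
     else bottom_arcs_from (as[i - 1 := y, i := k]) (Suc k) gs)"

text \<open>The arcs at the top are \<open>0, \<dots>, m - 1\<close>; the \<open>j\<close>-th crossing (from \<open>0\<close>) begins arc \<open>m + j\<close>.\<close>

definition braid_crossings :: "nat \<Rightarrow> int list \<Rightarrow> crossing list" where
  "braid_crossings m w = crossings_from [0..<m] m w"

definition braid_bottom_arcs :: "nat \<Rightarrow> int list \<Rightarrow> nat list" where
  "braid_bottom_arcs m w = bottom_arcs_from [0..<m] m w"

text \<open>
  Abelianized Fox derivatives of the Wirtinger relations, in the variable \<open>t\<close>: a crossing gives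
  the relation \<open>(1 - t) over + t left - right = 0\<close>. The coefficients are added up when arcs of the
  crossing coincide.
\<close>

definition crossing_coeff :: "crossing \<Rightarrow> nat \<Rightarrow> int poly" where
  "crossing_coeff c a =
     (if a = over c then [:1, -1:] else 0) + (if a = left c then [:0, 1:] else 0)
       + (if a = right c then -1 else 0)"

text \<open>
  Closing the braid joins the bottom of each position to its top, so the labels at the two ends
  name the same arc; this is the relation \<open>bottom - top = 0\<close>.
\<close>

definition closing_coeff :: "nat \<Rightarrow> int list \<Rightarrow> nat \<Rightarrow> nat \<Rightarrow> int poly" where
  "closing_coeff m w i a =
     (if a = braid_bottom_arcs m w ! i then 1 else 0) - (if a = i then 1 else 0)"

text \<open>
  The Alexander matrix of the closure of the braid: columns are indexed by the arc labels, rows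
  \<open>0, \<dots>, m - 1\<close> by the closing relations, the other rows by the crossings.
\<close>

definition alexander_matrix :: "nat \<Rightarrow> int list \<Rightarrow> int poly mat" where
  "alexander_matrix m w =
     mat (m + length w) (m + length w)
       (\<lambda>(r, a). if r < m then closing_coeff m w r a
                 else crossing_coeff (braid_crossings m w ! (r - m)) a)"

text \<open>
  The Alexander polynomial is determined by the link only up to a unit \<open>\<plusminus>t\<^sup>k\<close> of the Laurent
  polynomial ring over the integers. Up to such a unit it is the minor obtained by deleting any
  one row and any one column; we delete the first of each.
\<close>

definition alexander_polynomial :: "nat \<Rightarrow> int list \<Rightarrow> int poly" where
  "alexander_polynomial m w = det (mat_delete (alexander_matrix m w) 0 0)"

definition closure_determinant :: "nat \<Rightarrow> int list \<Rightarrow> nat" where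
  "closure_determinant m w = nat \<bar>poly (alexander_polynomial m w) (-1)\<bar>"

definition turks_head_braid :: "nat \<Rightarrow> nat \<Rightarrow> int list" where
  "turks_head_braid m n =
     concat (replicate n (map (\<lambda>i. if odd i then int i else - int i) [1..<m]))"

definition thk_determinant :: "nat \<Rightarrow> nat \<Rightarrow> nat" where
  "thk_determinant m n = closure_determinant m (turks_head_braid m n)"

definition composite :: "nat \<Rightarrow> bool" where
  "composite k \<longleftrightarrow> 1 < k \<and> \<not> prime k"

end

theory Submission
  imports Defs "HOL-Number_Theory.Fib"
begin

text \<open>
  At \<open>t = - 1\<close> the rows of the Alexander matrix become the equations \<open>2 over - left - right = 0\<close> of
  Fox colourings of the arcs by integers. The determinant is that of the reduced matrix \<open>A\<close>, whose
  kernel modulo \<open>q\<close> consists of the colourings modulo \<open>q\<close> that vanish on the first arc. Such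
  colourings are easiest to see on the faces of the braid diagram: a potential \<open>P\<close> on the faces
  colours the arc between two neighbouring faces by the sum of their values, and passing a
  crossing changes the potential of a single face. So a colouring of the closed braid is a
  potential on the \<open>m + 1\<close> faces above the braid that \<open>n\<close> sweeps through a block reproduce, up to
  prescribed differences along the closing strands.

  For even \<open>m = 2 k\<close> the odd-numbered faces are the vertices of the cylinder grid
  \<open>P\<^sub>k \<times> C\<^sub>n\<close>, a checkerboard graph of the diagram. A sweep relates the even-numbered faces
  to them like a harmonic conjugate, so that a colouring restricts to a harmonic function on the
  grid. By the maximum principle only constant functions are harmonic. They come from constant
  colourings, which vanish with the colour of the first arc, hence \<open>det A \<noteq> 0\<close>. The
  potential that grows linearly around the cylinder closes up modulo \<open>n\<close>, hence \<open>n\<close> divides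
  \<open>det A\<close>. If \<open>\<bar>det A\<bar>\<close> were equal to \<open>n\<close>, this one colouring would generate the cokernel of \<open>A\<close>, and
  every closing condition could be met over the integers up to a constant. Applied to a suitable
  condition, this yields an integral potential on the grid, up to a linear drift around the
  cylinder, whose Laplacian is a unit dipole on an edge between two different circles. The
  difference of the potential over this edge is an integer, but it is an effective resistance,
  which lies strictly between \<open>0\<close> and \<open>1\<close> because the edge lies on a square. So \<open>\<bar>det A\<bar>\<close> is a
  proper nonzero multiple of \<open>n\<close>, and therefore composite.

  For \<open>m = 3\<close> a sweep acts on two face potentials as a matrix of Fibonacci numbers with
  eigenvalues the squares of the golden ratio and of its conjugate. With \<open>q\<close> the Lucas number
  \<open>L\<^sub>n\<close> for odd \<open>n\<close> and the Fibonacci number \<open>F\<^sub>n\<close> for even \<open>n\<close>, the \<open>n\<close>-th power of this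
  matrix is congruent to the identity modulo \<open>q\<close>. Hence all choices of the top colours give
  colourings modulo \<open>q\<close>, there are two independent ones that vanish on the first arc, and \<open>q\<^sup>2\<close>
  divides the nonzero determinant.
\<close>

section \<open>Determinants and kernels modulo an integer\<close>

lemma cofactor_replace_col:
  fixes A :: "int mat"
  assumes A: "A \<in> carrier_mat N N" and i: "i < N" and j: "j < N"
  shows "cofactor (replace_col A b j) i j = cofactor A i j"
proof -
  have "mat_delete (replace_col A b j) i j = mat_delete A i j"
    by (rule eq_matI) (use A i j in \<open>auto simp: mat_delete_def replace_col_def\<close>)
  thus ?thesis by (simp add: cofactor_def)
qed

lemma det_replace_col:
  fixes A :: "int mat"
  assumes A: "A \<in> carrier_mat N N" and j: "j < N"
  shows "det (replace_col A b j) = (\<Sum>i<N. b $ i * cofactor A i j)"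
proof -
  have B: "replace_col A b j \<in> carrier_mat N N" using A by (auto simp: replace_col_def)
  show ?thesis
    unfolding laplace_expansion_column[OF B j]
    by (rule sum.cong)
      (use A j cofactor_replace_col[OF A _ j, of _ b] in \<open>auto simp: replace_col_def\<close>)
qed

text \<open>
  Cramer's rule for the right-hand side \<open>q b\<close>; the factor \<open>q\<close> can be pulled out of the replaced
  column.
\<close>

lemma det_replace_col_quotient:
  fixes A :: "int mat"
  assumes A: "A \<in> carrier_mat N N" and v: "v \<in> carrier_vec N" and j: "j < N"
    and b: "b \<in> carrier_vec N" and Av: "A *\<^sub>v v = q \<cdot>\<^sub>v b"
  shows "v $ j * det A = q * det (replace_col A b j)"
proof -
  have "v $ j * det A = det (replace_col A (q \<cdot>\<^sub>v b) j)"
    using cramer_lemma_mat[OF A v j] Av by simp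
  also have "\<dots> = q * det (replace_col A b j)"
    unfolding det_replace_col[OF A j] using b by (simp add: sum_distrib_left mult.assoc)
  finally show ?thesis .
qed

lemma replace_col_mult_vec:
  fixes A :: "int mat"
  assumes A: "A \<in> carrier_mat N N" and x: "x \<in> carrier_vec N" and j: "j < N"
    and b: "b \<in> carrier_vec N"
  shows "replace_col A b j *\<^sub>v x
    = A *\<^sub>v vec N (\<lambda>i. if i = j then 0 else x $ i) + x $ j \<cdot>\<^sub>v b"
proof (rule eq_vecI)
  fix i assume "i < dim_vec (A *\<^sub>v vec N (\<lambda>i. if i = j then 0 else x $ i) + x $ j \<cdot>\<^sub>v b)"
  with b have i: "i < N" by simp
  have "(replace_col A b j *\<^sub>v x) $ i
      = (\<Sum>l\<in>{0..<N}. (if l = j then b $ i else A $$ (i, l)) * x $ l)"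
    using A x i by (auto simp: replace_col_def scalar_prod_def intro!: sum.cong)
  also have "\<dots> = b $ i * x $ j + (\<Sum>l\<in>{0..<N} - {j}. A $$ (i, l) * x $ l)"
    using j by (subst sum.remove[of _ j]) (auto intro!: sum.cong)
  also have "(\<Sum>l\<in>{0..<N} - {j}. A $$ (i, l) * x $ l)
      = (\<Sum>l\<in>{0..<N}. A $$ (i, l) * (if l = j then 0 else x $ l))"
    using j by (subst (2) sum.remove[of _ j]) (auto intro!: sum.cong)
  also have "\<dots> = (A *\<^sub>v vec N (\<lambda>i. if i = j then 0 else x $ i)) $ i"
    using A x i by (auto simp: scalar_prod_def intro!: sum.cong)
  finally show "(replace_col A b j *\<^sub>v x) $ i
      = (A *\<^sub>v vec N (\<lambda>i. if i = j then 0 else x $ i) + x $ j \<cdot>\<^sub>v b) $ i"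
    using A b x i by simp
qed (use A b in \<open>auto simp: replace_col_def\<close>)

text \<open>
  A vector in the kernel modulo \<open>q\<close> forces \<open>q\<close> into the determinant as soon as one of its entries is a
  unit, since it can then replace a column by a change of basis over the integers.
\<close>

lemma dvd_det_if_kernel_mod:
  fixes A :: "int mat"
  assumes A: "A \<in> carrier_mat N N" and v: "v \<in> carrier_vec N" and j: "j < N"
    and b: "b \<in> carrier_vec N" and Av: "A *\<^sub>v v = q \<cdot>\<^sub>v b" and vj: "\<bar>v $ j\<bar> = 1"
  shows "q dvd det A"
proof -
  have "q dvd v $ j * det A" unfolding det_replace_col_quotient[OF A v j b Av] by simp
  thus ?thesis using vj by (auto simp: abs_if split: if_splits)
qed

lemma unimodular_solvable:
  fixes A :: "int mat"
  assumes A: "A \<in> carrier_mat N N" and d: "\<bar>det A\<bar> = 1" and z: "z \<in> carrier_vec N"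
  obtains x where "x \<in> carrier_vec N" "A *\<^sub>v x = z"
proof
  let ?z = "det A \<cdot>\<^sub>v z"
  note adj = adj_mat[OF A]
  have z': "?z \<in> carrier_vec N" using z by simp
  have dd: "det A * det A = 1" using d by (auto simp: abs_if split: if_splits)
  show "adj_mat A *\<^sub>v ?z \<in> carrier_vec N" using adj(1) z' by auto
  have "A *\<^sub>v (adj_mat A *\<^sub>v ?z) = (det A \<cdot>\<^sub>m 1\<^sub>m N) *\<^sub>v ?z"
    using assoc_mult_mat_vec[OF A adj(1) z'] adj(2) by simp
  also have "\<dots> = det A \<cdot>\<^sub>v ?z"
    using z' by (intro eq_vecI) (auto simp: scalar_prod_def if_distrib[of "\<lambda>x. x * _"]
        if_distrib[of "\<lambda>x. det A * x"] cong: if_cong)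
  also have "\<dots> = z" using dd z by (auto simp: smult_smult_assoc)
  finally show "A *\<^sub>v (adj_mat A *\<^sub>v ?z) = z" .
qed

text \<open>
  When the divisor found from \<open>v\<close> exhausts the determinant, replacing column \<open>j\<close> by \<open>b\<close> leaves a
  unimodular matrix. So \<open>b\<close> generates the cokernel of \<open>A\<close>.
\<close>

lemma solvable_of_abs_det_eq:
  fixes A :: "int mat"
  assumes A: "A \<in> carrier_mat N N" and v: "v \<in> carrier_vec N" and j: "j < N"
    and b: "b \<in> carrier_vec N" and Av: "A *\<^sub>v v = q \<cdot>\<^sub>v b" and vj: "\<bar>v $ j\<bar> = 1"
    and q: "q > 0" and dq: "\<bar>det A\<bar> = q" and z: "z \<in> carrier_vec N"
  obtains y t where "y \<in> carrier_vec N" "A *\<^sub>v y + t \<cdot>\<^sub>v b = z"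
proof -
  have B: "replace_col A b j \<in> carrier_mat N N" using A by (auto simp: replace_col_def)
  have "q * \<bar>det (replace_col A b j)\<bar> = \<bar>v $ j\<bar> * \<bar>det A\<bar>"
    using det_replace_col_quotient[OF A v j b Av] q by (metis abs_mult abs_of_pos)
  hence "\<bar>det (replace_col A b j)\<bar> = 1" using vj dq q by simp
  then obtain x where x: "x \<in> carrier_vec N" "replace_col A b j *\<^sub>v x = z"
    using unimodular_solvable[OF B _ z] by blast
  show ?thesis
    using that[of "vec N (\<lambda>i. if i = j then 0 else x $ i)" "x $ j"]
      replace_col_mult_vec[OF A x(1) j b] x(2) by auto
qed

text \<open>
  The second vector has entry \<open>0\<close> in the column replaced by means of the first, so it remains in the
  kernel modulo \<open>q\<close> after the replacement and contributes a second factor \<open>q\<close>.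
\<close>

lemma square_dvd_det:
  fixes A :: "int mat"
  assumes A: "A \<in> carrier_mat N N"
    and v: "v \<in> carrier_vec N" and v': "v' \<in> carrier_vec N"
    and b: "b \<in> carrier_vec N" and b': "b' \<in> carrier_vec N"
    and Av: "A *\<^sub>v v = q \<cdot>\<^sub>v b" and Av': "A *\<^sub>v v' = q \<cdot>\<^sub>v b'"
    and j: "j < N" and j': "j' < N" and vj: "v $ j = 1" and v'j: "v' $ j = 0" and v'j': "v' $ j' = 1"
  shows "q\<^sup>2 dvd det A"
proof -
  let ?B = "replace_col A b j"
  have B: "?B \<in> carrier_mat N N" using A by (auto simp: replace_col_def)
  have "vec N (\<lambda>i. if i = j then 0 else v' $ i) = v'" using v' v'j by auto
  hence "?B *\<^sub>v v' = q \<cdot>\<^sub>v b'"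
    using replace_col_mult_vec[OF A v' j b] v'j Av' b b' by auto
  hence "q dvd det ?B" using dvd_det_if_kernel_mod[OF B v' j' b'] v'j' by simp
  thus ?thesis using det_replace_col_quotient[OF A v j b Av] vj by (auto simp: power2_eq_square)
qed

section \<open>The maximum principle on a cylinder grid\<close>

text \<open>
  The rows \<open>s < k\<close> form a path and the second coordinate runs around the cylinder. The value belongs to
  the vertex \<open>(s, T + 1)\<close>, which always has a predecessor in its row.
\<close>

definition cylinder_laplacian :: "nat \<Rightarrow> (nat \<Rightarrow> nat \<Rightarrow> int) \<Rightarrow> nat \<Rightarrow> nat \<Rightarrow> int" where
  "cylinder_laplacian k X s T =
     (X s (T + 2) - X s (T + 1)) + (X s T - X s (T + 1))
     + (if s + 1 < k then X (s + 1) (T + 1) - X s (T + 1) else 0)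
     + (if 0 < s then X (s - 1) (T + 1) - X s (T + 1) else 0)"

lemma cylinder_laplacian_uminus:
  "cylinder_laplacian k (\<lambda>s T. - X s T) s T = - cylinder_laplacian k X s T"
  by (simp add: cylinder_laplacian_def)

locale periodic_cylinder =
  fixes k n :: nat and X :: "nat \<Rightarrow> nat \<Rightarrow> int"
  assumes k: "k > 0" and n: "n > 0"
    and periodic: "s < k \<Longrightarrow> X s (T + n) = X s T"
begin

lemma periodic_mult: "s < k \<Longrightarrow> X s (T + a * n) = X s T"
proof (induction a)
  case (Suc a)
  have "X s (T + Suc a * n) = X s (T + a * n + n)" by (simp add: algebra_simps)
  thus ?case using Suc periodic by simp
qed simp

lemma periodic_mod: "s < k \<Longrightarrow> X s T = X s (T mod n)"
  using periodic_mult[of s "T mod n" "T div n"] by simp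

lemma maximum:
  obtains s T where "s < k" "\<And>s' T'. s' < k \<Longrightarrow> X s' T' \<le> X s T"
proof -
  let ?S = "(\<lambda>(s, T). X s T) ` ({..<k} \<times> {..<n})"
  have fin: "finite ?S" and ne: "?S \<noteq> {}" using k n by (auto simp: lessThan_empty_iff)
  have "Max ?S \<in> ?S" using Max_in[OF fin ne] .
  then obtain s T where "s < k" "X s T = Max ?S" by fastforce
  moreover have "X s T \<le> Max ?S" if "s < k" for s T
  proof -
    have "X s (T mod n) \<in> ?S" using that n by force
    thus ?thesis using Max_ge[OF fin] periodic_mod[OF that, of T] by simp
  qed
  ultimately show ?thesis using that[of s T] by metis
qed

lemma laplacian_nonneg_at_maximum:
  assumes s: "s < k" and T: "X s (Suc T) = M" and ub: "\<And>s T. s < k \<Longrightarrow> X s T \<le> M"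
    and L: "cylinder_laplacian k X s T \<ge> 0"
  shows "X s (Suc (Suc T)) = M" "X s T = M"
    "s + 1 < k \<Longrightarrow> X (s + 1) (Suc T) = M" "0 < s \<Longrightarrow> X (s - 1) (Suc T) = M"
proof -
  have 1: "X s (T + 2) \<le> M" "X s T \<le> M" using ub s by auto
  have 2: "s + 1 < k \<Longrightarrow> X (s + 1) (T + 1) \<le> M" "X (s - 1) (T + 1) \<le> M" using ub s by auto
  show "X s (Suc (Suc T)) = M" "X s T = M"
    "s + 1 < k \<Longrightarrow> X (s + 1) (Suc T) = M" "0 < s \<Longrightarrow> X (s - 1) (Suc T) = M"
    using 1 2 L T unfolding cylinder_laplacian_def by (auto split: if_splits)
qed

text \<open>
  Where the Laplacian is nonnegative, a maximum is shared by all neighbours, so it spreads over the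
  connected grid.
\<close>

lemma constant_if_subharmonic_at_maximum:
  assumes ub: "\<And>s T. s < k \<Longrightarrow> X s T \<le> M"
    and s0: "s0 < k" "X s0 T0 = M"
    and sub: "\<And>s T. s < k \<Longrightarrow> X s (Suc T) = M \<Longrightarrow> cylinder_laplacian k X s T \<ge> 0"
    and s: "s < k"
  shows "X s T = M"
proof -
  have spread: "X s (Suc T) = M" "s + 1 < k \<Longrightarrow> X (s + 1) T = M" "0 < s \<Longrightarrow> X (s - 1) T = M"
    if sk: "s < k" and X: "X s T = M" for s T
  proof -
    obtain T' where T': "T + n = Suc T'" using n by (cases "T + n") auto
    have "X s (Suc T') = M" using periodic[OF sk] X T' by metis
    note nbr = laplacian_nonneg_at_maximum[OF sk this ub sub[OF sk this]]
    show "X s (Suc T) = M" using nbr(1) periodic[OF sk, of "Suc T"] T' by simp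
    show "s + 1 < k \<Longrightarrow> X (s + 1) T = M" using nbr(3) periodic[of "s + 1" T] T' by simp
    show "0 < s \<Longrightarrow> X (s - 1) T = M" using nbr(4) periodic[of "s - 1" T] T' sk by simp
  qed
  have later: "X s0 (T0 + d) = M" for d
    by (induction d) (use s0 spread(1) in auto)
  have row: "X s0 T = M" for T
  proof -
    have "X s0 T = X s0 (T + T0 * n)" using periodic_mult s0 by simp
    also have "T + T0 * n = T0 + (T + T0 * n - T0)" using n by (cases n) auto
    finally show ?thesis using later by simp
  qed
  show ?thesis
  proof (cases "s0 \<le> s")
    case True
    thus ?thesis using s
    proof (induction s rule: dec_induct)
      case base thus ?case using row by simp
    next
      case (step s) thus ?case using spread(2)[of s] by simp
    qed
  next
    case False
    hence "s \<le> s0" by simp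
    thus ?thesis
    proof (induction s rule: inc_induct)
      case base thus ?case using row by simp
    next
      case (step s) thus ?case using spread(3)[of "Suc s"] s0 by simp
    qed
  qed
qed

lemma harmonic_constant:
  assumes "\<And>s T. s < k \<Longrightarrow> cylinder_laplacian k X s T = 0"
  obtains M where "\<And>s T. s < k \<Longrightarrow> X s T = M"
proof -
  obtain s T where M: "s < k" "\<And>s' T'. s' < k \<Longrightarrow> X s' T' \<le> X s T"
    using maximum by blast
  show ?thesis
    by (rule that[of "X s T"], rule constant_if_subharmonic_at_maximum[OF M(2) M(1) refl])
      (use assms in auto)
qed

text \<open>
  If the maximum were missed at the only place where the Laplacian may be negative, the function would
  be constant and attain it there as well.
\<close>

lemma maximum_at_sink:
  assumes q: "q > 0" and a: "a < k"
    and lap: "\<And>s T. s < k \<Longrightarrow> \<not> (s = a \<and> n dvd Suc T + c) \<Longrightarrow> cylinder_laplacian k X s T \<ge> 0"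
    and lapa: "\<And>T. n dvd Suc T + c \<Longrightarrow> cylinder_laplacian k X a T = - q"
    and T0: "n dvd T0 + c" and s: "s < k"
  shows "X s T \<le> X a T0"
proof -
  obtain s1 T1 where s1: "s1 < k" and max: "\<And>s T. s < k \<Longrightarrow> X s T \<le> X s1 T1"
    using maximum by blast
  define M where "M = X s1 T1"
  note M = s1 M_def[symmetric] max[folded M_def]
  have "X a T0 = M"
  proof (rule ccontr)
    assume ne: "X a T0 \<noteq> M"
    have "X a T \<noteq> M" if "n dvd T + c" for T
    proof -
      have "int n dvd int (T + c) - int (T0 + c)" using that T0 by (intro dvd_diff) (simp_all only: of_nat_dvd_iff)
      hence "int T mod int n = int T0 mod int n" by (simp add: mod_eq_dvd_iff)
      hence "T mod n = T0 mod n" by (metis of_nat_eq_iff zmod_int)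
      thus ?thesis using ne periodic_mod[OF a] by metis
    qed
    hence const: "X s T = M" if "s < k" for s T
      by (intro constant_if_subharmonic_at_maximum[OF M(3) M(1,2) _ that]) (use lap in blast)+
    show False using const[OF a] ne by simp
  qed
  thus ?thesis using M(3) s by simp
qed

text \<open>
  The function has its maximum at \<open>(k - 1, T)\<close> and its minimum at \<open>(k - 2, T)\<close>. The current \<open>q\<close> leaves
  the maximum through edges on which the function does not increase, so it drops by at most \<open>q\<close> along the edge
  between the two vertices, and divisibility leaves only the drops \<open>0\<close> and \<open>q\<close>. A drop \<open>0\<close> makes the
  function constant. A drop \<open>q\<close> sends all current through the edge, so that the maximum is also
  attained at the next vertex \<open>(k - 1, T + 1)\<close> of the row; from there it spreads around the square
  to \<open>(k - 2, T)\<close>.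
\<close>

lemma no_integral_dipole:
  assumes k2: "k \<ge> 2" and n2: "n \<ge> 2" and q: "q > 0"
    and lap: "\<And>s T. s < k \<Longrightarrow> cylinder_laplacian k X s T =
      (if n dvd Suc T + c then q * ((if s = k - 2 then 1 else 0) - (if s = k - 1 then 1 else 0)) else 0)"
    and dv: "\<And>T. n dvd T + c \<Longrightarrow> q dvd X (k - 1) T - X (k - 2) T"
  shows False
proof -
  interpret neg: periodic_cylinder k n "\<lambda>s T. - X s T"
    by unfold_locales (use k n periodic in auto)
  let ?T = "n * (c + 1) - c"
  have gt: "n * (c + 1) > c" using n by (cases n) auto
  hence T: "n dvd ?T + c" by simp
  obtain T' where T': "?T = Suc T'" using gt by (cases ?T) auto
  let ?a = "k - 1" and ?b = "k - 2"
  define M where "M = X ?a ?T"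
  have ub: "X s T \<le> M" if "s < k" for s T
    unfolding M_def
    by (rule maximum_at_sink[OF q _ _ _ T that]) (use lap k2 q in \<open>auto split: if_splits\<close>)
  have "- X s T \<le> - X ?b ?T" if "s < k" for s T
    by (rule neg.maximum_at_sink[OF q _ _ _ T that])
      (use lap k2 q in \<open>auto simp: cylinder_laplacian_uminus split: if_splits\<close>)
  hence lb: "X ?b ?T \<le> X s T" if "s < k" for s T using that by fastforce
  have b: "?b + 1 = ?a" "?a - 1 = ?b" "?a < k" "?b < k" "?a > 0" using k2 by auto
  have "cylinder_laplacian k X ?a T' = - q" using lap[of ?a T'] T T' b by auto
  hence sum: "(X ?a (Suc ?T) - M) + (X ?a T' - M) + (X ?b ?T - M) = - q"
    using T' b unfolding cylinder_laplacian_def M_def by (simp add: numeral_2_eq_2)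
  have le: "X ?a (Suc ?T) \<le> M" "X ?a T' \<le> M" "X ?b ?T \<le> M" using ub b by auto
  obtain e where e: "M - X ?b ?T = q * e" using dv[OF T] unfolding M_def by (auto elim: dvdE)
  have "q * e \<le> q * 1" "0 \<le> q * e" using sum le e by auto
  hence "e \<le> 1" "0 \<le> e" using q by (auto simp: zero_le_mult_iff)
  moreover have "e \<noteq> 0"
  proof
    assume "e = 0"
    hence "X s T = M" if "s < k" for s T using e lb[OF that] ub[OF that] by (metis antisym eq_iff_diff_eq_0 mult_zero_right)
    thus False using sum q b by simp
  qed
  ultimately have "e = 1" by simp
  hence up: "X ?a (Suc ?T) = M" and bT: "X ?b ?T = M - q" using sum le e by auto
  \<comment> \<open>The vertices at \<open>?T + 1\<close> are harmonic, so the maximum spreads around the square.\<close>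
  have ndvd: "\<not> n dvd Suc ?T + c"
  proof
    assume "n dvd Suc ?T + c"
    hence "n dvd (Suc ?T + c) - (?T + c)" using T dvd_diff_nat by blast
    thus False using n2 by simp
  qed
  have "cylinder_laplacian k X ?a ?T \<ge> 0" using lap[of ?a ?T] ndvd b by auto
  from laplacian_nonneg_at_maximum(4)[OF b(3) up ub this] have "X ?b (Suc ?T) = M" using b by simp
  moreover have "cylinder_laplacian k X ?b ?T \<ge> 0" using lap[of ?b ?T] ndvd b by auto
  ultimately have "X ?b ?T = M" using laplacian_nonneg_at_maximum(2)[OF b(4) _ ub] by blast
  thus False using bT q by simp
qed

end

section \<open>Colourings of braid closures\<close>

definition valid_word :: "nat \<Rightarrow> int list \<Rightarrow> bool" where
  "valid_word m w \<longleftrightarrow> (\<forall>g\<in>set w. g \<noteq> 0 \<and> nat \<bar>g\<bar> < m)"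

definition crossing_defect :: "(nat \<Rightarrow> int) \<Rightarrow> crossing \<Rightarrow> int" where
  "crossing_defect u c = 2 * u (over c) - u (left c) - u (right c)"

text \<open>
  Faces are numbered from the left: face \<open>i\<close> lies between list positions \<open>i - 1\<close> and \<open>i\<close>, and
  generator \<open>i\<close> replaces this face only. Requiring that both strands at the crossing be sums of the
  adjacent potentials and obey the Fox relation determines the new value.
\<close>

definition face_move :: "int \<Rightarrow> (nat \<Rightarrow> int) \<Rightarrow> nat \<Rightarrow> int" where
  "face_move g P = (let i = nat \<bar>g\<bar> in P(i := P i + sgn g * (P (i - 1) - P (i + 1))))"

definition coloured_by_faces :: "nat \<Rightarrow> (nat \<Rightarrow> int) \<Rightarrow> nat list \<Rightarrow> (nat \<Rightarrow> int) \<Rightarrow> bool" where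
  "coloured_by_faces m u as P \<longleftrightarrow> (\<forall>i<m. u (as ! i) = P i + P (Suc i))"

lemma valid_word_Cons:
  "valid_word m (g # gs) \<longleftrightarrow> g \<noteq> 0 \<and> nat \<bar>g\<bar> < m \<and> valid_word m gs"
  by (auto simp: valid_word_def)

lemma length_crossings_from [simp]: "length (crossings_from as k gs) = length gs"
  by (induction as k gs rule: crossings_from.induct) (auto simp: Let_def)

lemma length_bottom_arcs_from [simp]: "length (bottom_arcs_from as k gs) = length as"
  by (induction as k gs rule: bottom_arcs_from.induct) (auto simp: Let_def)

lemma generator_positions:
  assumes "valid_word m (g # gs)" "length as = m"
  shows "nat \<bar>g\<bar> - 1 < length as" "nat \<bar>g\<bar> < length as" "nat \<bar>g\<bar> \<noteq> 0"
    "as ! (nat \<bar>g\<bar> - 1) \<in> set as" "as ! nat \<bar>g\<bar> \<in> set as"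
  using assms by (auto simp: valid_word_Cons)

lemma set_two_updates:
  assumes "set as \<subseteq> {..<k}" "x < k"
  shows "set (as[i := k, j := x]) \<subseteq> {..<Suc k}" "set (as[i := x, j := k]) \<subseteq> {..<Suc k}"
proof -
  have "set (as[i := a, j := b]) \<subseteq> insert a (insert b (set as))" for a b
    using set_update_subset_insert[of "as[i := a]" j b] set_update_subset_insert[of as i a] by auto
  from this[of k x] this[of x k] show "set (as[i := k, j := x]) \<subseteq> {..<Suc k}"
    "set (as[i := x, j := k]) \<subseteq> {..<Suc k}" using assms by (force)+
qed

lemma arcs_bounded:
  assumes "valid_word m gs" "length as = m" "set as \<subseteq> {..<k}"
  shows "set (bottom_arcs_from as k gs) \<subseteq> {..<k + length gs} \<and>
    (\<forall>c\<in>set (crossings_from as k gs).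
      over c < k + length gs \<and> left c < k + length gs \<and> right c < k + length gs)"
  using assms
proof (induction as k gs rule: crossings_from.induct)
  case (2 as k g gs)
  define i where "i = nat \<bar>g\<bar>"
  note pos = generator_positions[OF 2(3,4), folded i_def]
  have v: "valid_word m gs" using 2 by (simp add: valid_word_Cons)
  have lt: "as ! (i - 1) < k" "as ! i < k" using pos(4,5) 2(5) by (metis lessThan_iff subsetD)+
  note up = set_two_updates[OF 2(5) lt(1), of "i - 1" i] set_two_updates[OF 2(5) lt(2), of "i - 1" i]
  show ?case
  proof (cases "g > 0")
    case True
    show ?thesis
      using 2(1)[OF i_def refl refl True v _ up(1)] True lt 2(4)
      by (auto simp: Let_def i_def)
  next
    case False
    show ?thesis
      using 2(2)[OF i_def refl refl False v _ up(4)] False lt 2(4)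
      by (auto simp: Let_def i_def)
  qed
qed auto

lemma colouring_extends:
  assumes "valid_word m gs" "length as = m" "set as \<subseteq> {..<k}"
  shows "\<exists>u'. (\<forall>a<k. u' a = u a) \<and> (\<forall>c\<in>set (crossings_from as k gs). crossing_defect u' c = 0)"
  using assms
proof (induction as k gs arbitrary: u rule: crossings_from.induct)
  case (2 as k g gs)
  define i where "i = nat \<bar>g\<bar>"
  note pos = generator_positions[OF 2(3,4), folded i_def]
  have v: "valid_word m gs" using 2 by (simp add: valid_word_Cons)
  have lt: "as ! (i - 1) < k" "as ! i < k" using pos(4,5) 2(5) by (metis lessThan_iff subsetD)+
  note up = set_two_updates[OF 2(5) lt(1), of "i - 1" i] set_two_updates[OF 2(5) lt(2), of "i - 1" i]
  show ?case
  proof (cases "g > 0")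
    case True
    from 2(1)[OF i_def refl refl True v _ up(1), of "u(k := 2 * u (as ! (i - 1)) - u (as ! i))"] 2(4)
    obtain u' where "\<forall>a<Suc k. u' a = (u(k := 2 * u (as ! (i - 1)) - u (as ! i))) a"
      "\<forall>c\<in>set (crossings_from (as[i - 1 := k, i := as ! (i - 1)]) (Suc k) gs). crossing_defect u' c = 0"
      by auto
    thus ?thesis using True lt
      by (intro exI[of _ u']) (auto simp: Let_def i_def crossing_defect_def)
  next
    case False
    from 2(2)[OF i_def refl refl False v _ up(4), of "u(k := 2 * u (as ! i) - u (as ! (i - 1)))"] 2(4)
    obtain u' where "\<forall>a<Suc k. u' a = (u(k := 2 * u (as ! i) - u (as ! (i - 1)))) a"
      "\<forall>c\<in>set (crossings_from (as[i - 1 := as ! i, i := k]) (Suc k) gs). crossing_defect u' c = 0"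
      by auto
    thus ?thesis using False lt
      by (intro exI[of _ u']) (auto simp: Let_def i_def crossing_defect_def)
  qed
qed auto

text \<open>
  The Fox relations determine the new arcs one after the other from the arcs at the top.
\<close>

lemma zero_colouring:
  assumes "valid_word m gs" "length as = m" "\<forall>a<k. u a = 0" "set as \<subseteq> {..<k}"
    and "\<forall>c\<in>set (crossings_from as k gs). crossing_defect u c = 0"
  shows "\<forall>a<k + length gs. u a = 0"
  using assms
proof (induction as k gs rule: crossings_from.induct)
  case (2 as k g gs)
  define i where "i = nat \<bar>g\<bar>"
  note pos = generator_positions[OF 2(3,4), folded i_def]
  have v: "valid_word m gs" using 2 by (simp add: valid_word_Cons)
  have lt: "as ! (i - 1) < k" "as ! i < k" using pos(4,5) 2(6) by (metis lessThan_iff subsetD)+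
  note up = set_two_updates[OF 2(6) lt(1), of "i - 1" i] set_two_updates[OF 2(6) lt(2), of "i - 1" i]
  show ?case
  proof (cases "g > 0")
    case True
    have "u k = 0" using 2(5,7) lt True by (auto simp: Let_def i_def crossing_defect_def)
    hence "\<forall>a<Suc k. u a = 0" using 2(5) by (auto simp: less_Suc_eq)
    from 2(1)[OF i_def refl refl True v _ this up(1)] 2(4,7) True
    show ?thesis by (auto simp: Let_def i_def)
  next
    case False
    have "u k = 0" using 2(5,7) lt False by (auto simp: Let_def i_def crossing_defect_def)
    hence "\<forall>a<Suc k. u a = 0" using 2(5) by (auto simp: less_Suc_eq)
    from 2(2)[OF i_def refl refl False v _ this up(4)] 2(4,7) False
    show ?thesis by (auto simp: Let_def i_def)
  qed
qed auto

text \<open>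
  The value that the Fox relation gives to the new arc is the sum of the potentials of its two faces
  after the move.
\<close>

lemma coloured_by_faces_bottom:
  assumes "valid_word m gs" "length as = m" "coloured_by_faces m u as P"
    and "\<forall>c\<in>set (crossings_from as k gs). crossing_defect u c = 0"
  shows "coloured_by_faces m u (bottom_arcs_from as k gs) (fold face_move gs P)"
  using assms
proof (induction as k gs arbitrary: P rule: crossings_from.induct)
  case (2 as k g gs)
  define i where "i = nat \<bar>g\<bar>"
  note pos = generator_positions[OF 2(3,4), folded i_def]
  have v: "valid_word m gs" using 2 by (simp add: valid_word_Cons)
  obtain h where h: "i = Suc h" using pos(3) by (cases i) auto
  have im: "h < m" "Suc h < m" using pos(1,2) 2(4) h by auto
  have col: "u (as ! j) = P j + P (Suc j)" if "j < m" for j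
    using 2(5) that by (simp add: coloured_by_faces_def)
  show ?case
  proof (cases "g > 0")
    case True
    hence move: "face_move g P = P(Suc h := P (Suc h) + (P h - P (Suc (Suc h))))"
      using h by (simp add: face_move_def Let_def i_def)
    have uk: "u k = 2 * (P h + P (Suc h)) - (P (Suc h) + P (Suc (Suc h)))"
      using 2(6)[unfolded crossings_from.simps Let_def i_def[symmetric]] True
        h col[OF im(1)] col[OF im(2)]
      by (simp add: crossing_defect_def)
    have "coloured_by_faces m u (as[i - 1 := k, i := as ! (i - 1)]) (face_move g P)"
      unfolding coloured_by_faces_def
    proof (intro allI impI)
      fix j assume j: "j < m"
      consider "j = h" | "j = Suc h" | "j \<noteq> h" "j \<noteq> Suc h" by blast
      thus "u (as[i - 1 := k, i := as ! (i - 1)] ! j) = face_move g P j + face_move g P (Suc j)"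
        by cases (use j im 2(4) uk col[OF im(1)] col[OF j] in \<open>simp_all add: h move\<close>)
    qed
    from 2(1)[OF i_def refl refl True v _ this] 2(4,6) True
    show ?thesis by (simp add: Let_def i_def)
  next
    case False
    hence "sgn g = - 1" using 2(3) by (auto simp: valid_word_Cons sgn_if)
    hence move: "face_move g P = P(Suc h := P (Suc h) + (P (Suc (Suc h)) - P h))"
      using h by (simp add: face_move_def Let_def i_def)
    have uk: "u k = 2 * (P (Suc h) + P (Suc (Suc h))) - (P h + P (Suc h))"
      using 2(6)[unfolded crossings_from.simps Let_def i_def[symmetric]] False
        h col[OF im(1)] col[OF im(2)]
      by (simp add: crossing_defect_def)
    have "coloured_by_faces m u (as[i - 1 := as ! i, i := k]) (face_move g P)"
      unfolding coloured_by_faces_def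
    proof (intro allI impI)
      fix j assume j: "j < m"
      consider "j = h" | "j = Suc h" | "j \<noteq> h" "j \<noteq> Suc h" by blast
      thus "u (as[i - 1 := as ! i, i := k] ! j) = face_move g P j + face_move g P (Suc j)"
        by cases (use j im 2(4) uk col[OF im(2)] col[OF j] in \<open>simp_all add: h move\<close>)
    qed
    from 2(2)[OF i_def refl refl False v _ this] 2(4,6) False
    show ?thesis by (simp add: Let_def i_def)
  qed
qed auto

lemma face_move_end:
  assumes "valid_word m gs" "i = 0 \<or> m \<le> i"
  shows "fold face_move gs P i = P i"
  using assms(1)
proof (induction gs arbitrary: P)
  case (Cons g gs)
  thus ?case using assms(2) by (auto simp: valid_word_Cons face_move_def Let_def)
qed simp

text \<open>
  Evaluation at \<open>- 1\<close> comes before the determinant here, so all linear algebra is over the integers.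
\<close>

definition reduced_matrix :: "nat \<Rightarrow> int list \<Rightarrow> int mat" where
  "reduced_matrix m w = map_mat (\<lambda>p. poly p (- 1)) (mat_delete (alexander_matrix m w) 0 0)"

text \<open>
  Deleting the first column amounts to fixing the colour \<open>0\<close> on arc \<open>0\<close>, so the vector starts with arc \<open>1\<close>.
\<close>

definition colour_vec :: "nat \<Rightarrow> (nat \<Rightarrow> int) \<Rightarrow> int vec" where
  "colour_vec N u = vec N (\<lambda>a. u (Suc a))"

lemma closure_determinant_eq: "int (closure_determinant m w) = \<bar>det (reduced_matrix m w)\<bar>"
proof -
  interpret ev: comm_ring_hom "\<lambda>p :: int poly. poly p (- 1)"
    by unfold_locales auto
  show ?thesis
    by (simp add: closure_determinant_def alexander_polynomial_def reduced_matrix_def ev.hom_det)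
qed

lemma reduced_matrix_carrier [simp]:
  "reduced_matrix m w \<in> carrier_mat (m + length w - 1) (m + length w - 1)"
  by (auto simp: reduced_matrix_def alexander_matrix_def mat_delete_def)

lemma poly_crossing_coeff:
  "poly (crossing_coeff c a) (- 1) = (if a = over c then 2 else 0) - (if a = left c then 1 else 0)
    - (if a = right c then 1 else 0)"
  by (simp add: crossing_coeff_def)

lemma poly_closing_coeff:
  "poly (closing_coeff m w i a) (- 1) =
    (if a = braid_bottom_arcs m w ! i then 1 else 0) - (if a = i then 1 else 0)"
  by (simp add: closing_coeff_def)

lemma sum_indicator:
  fixes u :: "nat \<Rightarrow> int"
  assumes "b < N"
  shows "(\<Sum>a<N. (if a = b then c else 0) * u a) = c * u b"
  using assms by (simp add: if_distrib[of "\<lambda>x. x * _"] cong: if_cong)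

lemma reduced_matrix_mult:
  assumes w: "valid_word m w" and m: "m > 0" and u0: "u 0 = 0"
  shows "reduced_matrix m w *\<^sub>v colour_vec (m + length w - 1) u =
    vec (m + length w - 1) (\<lambda>r. if Suc r < m
      then u (braid_bottom_arcs m w ! Suc r) - u (Suc r)
      else crossing_defect u (braid_crossings m w ! (Suc r - m)))"
proof (rule eq_vecI)
  fix r assume "r < dim_vec (vec (m + length w - 1) (\<lambda>r. if Suc r < m
      then u (braid_bottom_arcs m w ! Suc r) - u (Suc r)
      else crossing_defect u (braid_crossings m w ! (Suc r - m))))"
  hence r: "Suc r < m + length w" by simp
  define N where "N = m + length w - 1"
  have N: "m + length w = Suc N" using m by (simp add: N_def)
  define f where "f a = poly (alexander_matrix m w $$ (Suc r, a)) (- 1)" for a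
  have bnd: "set (braid_bottom_arcs m w) \<subseteq> {..<Suc N}"
    "\<forall>c\<in>set (braid_crossings m w). over c < Suc N \<and> left c < Suc N \<and> right c < Suc N"
    using arcs_bounded[OF w, of "[0..<m]" m] N
    by (auto simp: braid_bottom_arcs_def braid_crossings_def atLeast0LessThan)
  have "(reduced_matrix m w *\<^sub>v colour_vec N u) $ r = (\<Sum>a<N. f (Suc a) * u (Suc a))"
    using r N by (auto simp: reduced_matrix_def colour_vec_def scalar_prod_def f_def
        mat_delete_def alexander_matrix_def atLeast0LessThan intro!: sum.cong)
  also have "\<dots> = (\<Sum>a<Suc N. f a * u a)"
    unfolding sum.lessThan_Suc_shift using u0 by simp
  also have "\<dots> = (if Suc r < m
      then u (braid_bottom_arcs m w ! Suc r) - u (Suc r)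
      else crossing_defect u (braid_crossings m w ! (Suc r - m)))"
  proof (cases "Suc r < m")
    case True
    hence b: "braid_bottom_arcs m w ! Suc r < Suc N"
      using subsetD[OF bnd(1) nth_mem[of "Suc r"]] by (simp add: braid_bottom_arcs_def)
    have "(\<Sum>a<Suc N. f a * u a) = (\<Sum>a<Suc N. (if a = braid_bottom_arcs m w ! Suc r then 1 else 0) * u a)
        - (\<Sum>a<Suc N. (if a = Suc r then 1 else 0) * u a)"
      unfolding sum_subtractf[symmetric]
      by (rule sum.cong) (use True r N in
        \<open>auto simp: f_def alexander_matrix_def poly_closing_coeff left_diff_distrib\<close>)
    thus ?thesis using True b r N by (simp add: sum_indicator)
  next
    case False
    define c where "c = braid_crossings m w ! (Suc r - m)"
    have "c \<in> set (braid_crossings m w)"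
      unfolding c_def by (rule nth_mem) (use False r in \<open>auto simp: braid_crossings_def\<close>)
    hence b: "over c < Suc N" "left c < Suc N" "right c < Suc N" using bnd(2) by auto
    have "(\<Sum>a<Suc N. f a * u a) = (\<Sum>a<Suc N. (if a = over c then 2 else 0) * u a)
        - (\<Sum>a<Suc N. (if a = left c then 1 else 0) * u a)
        - (\<Sum>a<Suc N. (if a = right c then 1 else 0) * u a)"
      unfolding sum_subtractf[symmetric]
      by (rule sum.cong) (use False r N in
        \<open>auto simp: f_def alexander_matrix_def poly_crossing_coeff left_diff_distrib c_def\<close>)
    thus ?thesis using False b by (simp add: sum_indicator crossing_defect_def c_def[symmetric])
  qed
  finally show "(reduced_matrix m w *\<^sub>v colour_vec (m + length w - 1) u) $ r =
    vec (m + length w - 1) (\<lambda>r. if Suc r < m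
      then u (braid_bottom_arcs m w ! Suc r) - u (Suc r)
      else crossing_defect u (braid_crossings m w ! (Suc r - m))) $ r"
    using r by (simp add: N_def)
qed (simp add: reduced_matrix_def mat_delete_def alexander_matrix_def)

text \<open>
  The right-hand sides that are \<open>0\<close> at all crossings: \<open>z i\<close> is the prescribed difference between the
  colours at the bottom and at the top of position \<open>i\<close>. Position \<open>0\<close> is the deleted row.
\<close>

definition closing_vec :: "nat \<Rightarrow> nat \<Rightarrow> (nat \<Rightarrow> int) \<Rightarrow> int vec" where
  "closing_vec m N z = vec N (\<lambda>r. if Suc r < m then z (Suc r) else 0)"

text \<open>
  Constructs a colouring from the potentials above the braid; it closes up except for the change of
  the potentials by the braid.
\<close>

lemma colouring_of_faces:
  assumes w: "valid_word m w" and m: "m > 0" and P: "P 0 + P 1 = 0"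
  obtains u where "u 0 = 0" "\<And>i. i < m \<Longrightarrow> u i = P i + P (Suc i)"
    "reduced_matrix m w *\<^sub>v colour_vec (m + length w - 1) u = closing_vec m (m + length w - 1)
      (\<lambda>i. (fold face_move w P i + fold face_move w P (Suc i)) - (P i + P (Suc i)))"
proof -
  obtain u where u: "\<forall>a<m. u a = P a + P (Suc a)"
    "\<forall>c\<in>set (braid_crossings m w). crossing_defect u c = 0"
    using colouring_extends[OF w, of "[0..<m]" m "\<lambda>a. P a + P (Suc a)"]
    by (auto simp: braid_crossings_def atLeast0LessThan)
  have u0: "u 0 = 0" using u(1) m P by auto
  have "coloured_by_faces m u [0..<m] P" using u(1) by (simp add: coloured_by_faces_def)
  from coloured_by_faces_bottom[OF w _ this, of m] u(2)
  have "coloured_by_faces m u (braid_bottom_arcs m w) (fold face_move w P)"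
    by (simp add: braid_bottom_arcs_def braid_crossings_def)
  hence "reduced_matrix m w *\<^sub>v colour_vec (m + length w - 1) u = closing_vec m (m + length w - 1)
      (\<lambda>i. (fold face_move w P i + fold face_move w P (Suc i)) - (P i + P (Suc i)))"
    unfolding reduced_matrix_mult[where u = u, OF w m u0] closing_vec_def
    using u by (intro eq_vecI) (auto simp: coloured_by_faces_def braid_crossings_def)
  thus ?thesis using that u0 u(1) by blast
qed

text \<open>
  Conversely, the colours at the top are alternately summed to potentials starting from \<open>P 0 = 0\<close>. The
  missing condition for position \<open>0\<close> follows from the remaining ones, because the outermost
  potentials are invariant under all moves.
\<close>

lemma faces_of_solution:
  assumes w: "valid_word m w" and m: "m > 0" and y: "y \<in> carrier_vec (m + length w - 1)"
    and eq: "reduced_matrix m w *\<^sub>v y = closing_vec m (m + length w - 1) z"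
  obtains P where "P 0 = 0" "P 1 = 0"
    "\<And>i. 0 < i \<Longrightarrow> i < m \<Longrightarrow>
      (fold face_move w P i + fold face_move w P (Suc i)) - (P i + P (Suc i)) = z i"
    "(\<And>i. i < m \<Longrightarrow> P i + P (Suc i) = 0) \<Longrightarrow> y = 0\<^sub>v (m + length w - 1)"
proof -
  define N where "N = m + length w - 1"
  define u where "u a = (case a of 0 \<Rightarrow> 0 | Suc b \<Rightarrow> y $ b)" for a
  define P where "P = rec_nat 0 (\<lambda>i p. u i - p)"
  have P: "P 0 = 0" "P (Suc i) = u i - P i" for i by (simp_all add: P_def)
  have u0: "u 0 = 0" by (simp add: u_def)
  have yu: "y = colour_vec N u" using y by (auto simp: colour_vec_def u_def N_def)
  have comp: "(if Suc r < m then u (braid_bottom_arcs m w ! Suc r) - u (Suc r)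
      else crossing_defect u (braid_crossings m w ! (Suc r - m))) = (if Suc r < m then z (Suc r) else 0)"
    if "r < N" for r
    using arg_cong[OF eq[unfolded yu N_def reduced_matrix_mult[where u = u, OF w m u0]], of "\<lambda>v. v $ r"] that
    by (simp add: closing_vec_def N_def)
  have cross: "\<forall>c\<in>set (crossings_from [0..<m] m w). crossing_defect u c = 0"
  proof
    fix c assume "c \<in> set (crossings_from [0..<m] m w)"
    then obtain l where l: "l < length w" "c = braid_crossings m w ! l"
      by (auto simp: in_set_conv_nth braid_crossings_def)
    have "l + m - 1 < N" "\<not> Suc (l + m - 1) < m" "Suc (l + m - 1) - m = l"
      using l m by (auto simp: N_def)
    thus "crossing_defect u c = 0" using comp[of "l + m - 1"] l by auto
  qed
  have "coloured_by_faces m u [0..<m] P" by (simp add: coloured_by_faces_def P)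
  from coloured_by_faces_bottom[OF w _ this cross]
  have bot: "coloured_by_faces m u (braid_bottom_arcs m w) (fold face_move w P)"
    by (simp add: braid_bottom_arcs_def)
  show ?thesis
  proof (rule that[of P])
    show "P 0 = 0" "P 1 = 0" using P(1) P(2)[of 0] u0 by auto
    show "(fold face_move w P i + fold face_move w P (Suc i)) - (P i + P (Suc i)) = z i"
      if "0 < i" "i < m" for i
      using comp[of "i - 1"] bot that m by (auto simp: coloured_by_faces_def N_def P)
    assume 0: "\<And>i. i < m \<Longrightarrow> P i + P (Suc i) = 0"
    hence "\<forall>a<m. u a = 0" by (simp add: P)
    from zero_colouring[OF w _ this _ cross] have "\<forall>a<m + length w. u a = 0"
      by (auto simp: atLeast0LessThan)
    thus "y = 0\<^sub>v (m + length w - 1)"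
      unfolding yu using m by (auto simp: colour_vec_def N_def)
  qed
qed

section \<open>Sweeps through the blocks of a Turk's head braid\<close>

definition thk_block :: "nat \<Rightarrow> int list" where
  "thk_block m = map (\<lambda>i. if odd i then int i else - int i) [1..<m]"

definition level :: "nat \<Rightarrow> nat \<Rightarrow> (nat \<Rightarrow> int) \<Rightarrow> nat \<Rightarrow> int" where
  "level m j P = (fold face_move (thk_block m) ^^ j) P"

lemma fold_turks_head: "fold face_move (turks_head_braid m n) P = level m n P"
  by (induction n arbitrary: P)
    (simp_all add: turks_head_braid_def level_def thk_block_def funpow_swap1)

lemma valid_turks_head: "valid_word m (turks_head_braid m n)"
  by (auto simp: valid_word_def turks_head_braid_def)

lemma valid_block: "valid_word m (thk_block m)"
  by (auto simp: valid_word_def thk_block_def)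

lemma length_turks_head: "length (turks_head_braid m n) = n * (m - 1)"
  by (simp add: turks_head_braid_def length_concat sum_list_replicate)

text \<open>
  The generators of a block come in increasing order, so the move at face \<open>i\<close> sees the new value on its
  left and the old value on its right.
\<close>

lemma fold_block:
  "(0 < i \<and> i \<le> l \<longrightarrow> fold face_move (thk_block (Suc l)) P i =
      P i + (if odd i then 1 else - 1) * (fold face_move (thk_block (Suc l)) P (i - 1) - P (Suc i)))
   \<and> (i = 0 \<or> l < i \<longrightarrow> fold face_move (thk_block (Suc l)) P i = P i)"
proof (induction l arbitrary: i)
  case 0
  thus ?case by (simp add: thk_block_def)
next
  case (Suc l)
  define Q where "Q = fold face_move (thk_block (Suc l)) P"
  have "thk_block (Suc (Suc l)) = thk_block (Suc l) @ [if odd (Suc l) then int (Suc l) else - int (Suc l)]"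
    by (simp add: thk_block_def)
  hence "fold face_move (thk_block (Suc (Suc l))) P
      = face_move (if odd (Suc l) then int (Suc l) else - int (Suc l)) Q"
    unfolding Q_def by (simp only: fold_append fold_simps comp_apply)
  also have "\<dots> = Q(Suc l := Q (Suc l) + (if odd (Suc l) then 1 else - 1) * (Q l - Q (Suc (Suc l))))"
  proof -
    let ?g = "if odd (Suc l) then int (Suc l) else - int (Suc l)"
    have "nat \<bar>?g\<bar> = Suc l" "sgn ?g = (if odd (Suc l) then 1 else - 1)" by (auto simp: sgn_if)
    thus ?thesis unfolding face_move_def Let_def by simp
  qed
  finally have step: "fold face_move (thk_block (Suc (Suc l))) P i =
      (if i = Suc l then Q (Suc l) + (if odd (Suc l) then 1 else - 1) * (Q l - Q (Suc (Suc l))) else Q i)" for i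
    by (simp only: fun_upd_apply)
  have IH: "0 < i \<and> i \<le> l \<longrightarrow> Q i = P i + (if odd i then 1 else - 1) * (Q (i - 1) - P (Suc i))"
    "i = 0 \<or> l < i \<longrightarrow> Q i = P i" for i
    using Suc.IH[of i] unfolding Q_def by blast+
  consider "i = 0" | "0 < i" "i \<le> l" | "i = Suc l" | "Suc l < i" by linarith
  thus ?case
  proof cases
    case 1
    thus ?thesis using IH(2)[of i] unfolding step by simp
  next
    case 2
    hence "i - 1 \<noteq> Suc l" "i \<noteq> Suc l" by auto
    thus ?thesis using IH(1)[of i] 2 unfolding step by auto
  next
    case 3
    have "Q (Suc l) = P (Suc l)" "Q (Suc (Suc l)) = P (Suc (Suc l))"
      using IH(2)[of "Suc l"] IH(2)[of "Suc (Suc l)"] by auto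
    thus ?thesis unfolding step 3 by simp
  next
    case 4
    thus ?thesis using IH(2)[of i] unfolding step by simp
  qed
qed

lemma level_0 [simp]: "level m 0 P = P"
  by (simp add: level_def)

lemma level_Suc: "level m (Suc j) P = fold face_move (thk_block m) (level m j P)"
  by (simp add: level_def)

lemma level_end:
  assumes "i = 0 \<or> m \<le> i"
  shows "level m j P i = P i"
  by (induction j) (use face_move_end[OF valid_block assms] in \<open>simp_all add: level_Suc\<close>)

lemma level_Suc_interior:
  assumes "0 < i" "i < m"
  shows "level m (Suc j) P i = level m j P i
    + (if odd i then 1 else - 1) * (level m (Suc j) P (i - 1) - level m j P (Suc i))"
proof -
  have "Suc (m - 1) = m" "i \<le> m - 1" using assms by simp_all
  thus ?thesis
    using fold_block[where i = i and l = "m - 1" and P = "level m j P", THEN conjunct1] assms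
    unfolding level_Suc by metis
qed

lemma level_odd:
  assumes "odd i" "i < m"
  shows "level m (Suc j) P i = level m j P i + level m (Suc j) P (i - 1) - level m j P (Suc i)"
proof -
  have "0 < i" using assms(1) by (rule odd_pos)
  from level_Suc_interior[OF this assms(2), of j P] show ?thesis by (simp only: assms(1) not_False_eq_True if_True mult_1 add_diff_eq)
qed

lemma level_even:
  assumes "even i" "0 < i" "i < m"
  shows "level m (Suc j) P i = level m j P i - level m (Suc j) P (i - 1) + level m j P (Suc i)"
proof -
  have "\<not> odd i" using assms(1) by simp
  with level_Suc_interior[OF assms(2,3), of j P] show ?thesis
    by (simp only: if_False mult_minus1 minus_diff_eq algebra_simps)
qed

text \<open>
  Potentials before each block, continued to all levels around the closed braid. Reading the rules
  as discrete Cauchy-Riemann equations, the values on the even faces are conjugate to those on the odd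
  faces. The parameter \<open>t\<close> is the drift of the odd faces per turn, and \<open>e\<close> a defect in the rule for the
  face \<open>2 k - 2\<close> at the last block of each turn.
\<close>

locale face_levels =
  fixes k n :: nat and H :: "nat \<Rightarrow> nat \<Rightarrow> int" and t e :: int
  assumes k2: "k \<ge> 2" and n2: "n \<ge> 2"
    and inner: "H j 0 = 0" and outer: "H j (2 * k) = H 0 (2 * k)"
    and odd_rule: "s < k \<Longrightarrow> H (Suc j) (2 * s + 1) = H j (2 * s + 1) + H (Suc j) (2 * s) - H j (2 * s + 2)"
    and even_rule: "Suc s < k \<Longrightarrow> H (Suc j) (2 * s + 2) = H j (2 * s + 2) - H (Suc j) (2 * s + 1) + H j (2 * s + 3)
      - (if n dvd Suc j \<and> s = k - 2 then e else 0)"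
    and shift: "s < k \<Longrightarrow> H (j + n) (2 * s + 1) = H j (2 * s + 1) - t"
begin

text \<open>
  Within a level, a sweep has already moved the left neighbour of a face when it reaches that face.
  Shifting the levels by \<open>s\<close> undoes this skew and makes the neighbours \<open>(s \<plusminus> 1, T)\<close> those of the
  upright grid. The summand \<open>k\<close> keeps the level natural.
\<close>

definition X :: "nat \<Rightarrow> nat \<Rightarrow> int" where
  "X s T = H (T + k - s) (2 * s + 1)"

lemma X_shift: "s < k \<Longrightarrow> X s (T + n) = X s T - t"
proof -
  assume s: "s < k"
  hence "T + n + k - s = (T + k - s) + n" by simp
  thus ?thesis using shift[OF s] by (simp add: X_def)
qed

text \<open>
  The second difference of an odd face is the difference of the rates of change of its two even
  neighbours, and each of these rates is in turn a difference of odd faces. At the outermost faces,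
  where the even potential is constant, the corresponding neighbour is absent. The defect \<open>e\<close> of the
  face between rows \<open>k - 2\<close> and \<open>k - 1\<close> enters their Laplacians with opposite signs.
\<close>

lemma laplacian_X:
  assumes s: "s < k"
  shows "cylinder_laplacian k X s T =
    (if n dvd Suc T + 2 then e * ((if s = k - 2 then 1 else 0) - (if s = k - 1 then 1 else 0)) else 0)"
proof -
  define J where "J = T + k - s"
  have J: "T + 2 + k - s = Suc (Suc J)" "T + 1 + k - s = Suc J" using s by (auto simp: J_def)
  have X: "X s (T + 2) = H (Suc (Suc J)) (2 * s + 1)" "X s (T + 1) = H (Suc J) (2 * s + 1)"
    "X s T = H J (2 * s + 1)" unfolding X_def J by (simp_all add: J_def)
  have up: "X (s + 1) (T + 1) = H J (2 * s + 3)"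
    unfolding X_def J_def by (simp add: numeral_3_eq_3)
  have down: "X (s - 1) (T + 1) = H (Suc (Suc J)) (2 * s - 1)" if "0 < s"
  proof -
    have "T + 1 + k - (s - 1) = Suc (Suc J)" "2 * (s - 1) + 1 = 2 * s - 1" using that s by (auto simp: J_def)
    thus ?thesis by (simp add: X_def)
  qed
  have inner_rate: "H (Suc (Suc J)) (2 * s) - H (Suc J) (2 * s) =
      (if 0 < s then H (Suc J) (2 * s + 1) - H (Suc (Suc J)) (2 * s - 1)
        - (if n dvd Suc (Suc J) \<and> s = k - 1 then e else 0) else 0)"
  proof (cases s)
    case 0 thus ?thesis by (simp add: inner)
  next
    case (Suc s')
    have eqs: "s' = k - 2 \<longleftrightarrow> s = k - 1" "2 * s' + 2 = 2 * s" "2 * s' + 1 = 2 * s - 1"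
      "2 * s' + 3 = 2 * s + 1" using Suc s by auto
    have "Suc s' < k" "0 < s" using Suc s by auto
    from even_rule[OF this(1), of "Suc J"]
    have "H (Suc (Suc J)) (2 * s) = H (Suc J) (2 * s) - H (Suc (Suc J)) (2 * s - 1) + H (Suc J) (2 * s + 1)
      - (if n dvd Suc (Suc J) \<and> s = k - 1 then e else 0)" by (simp only: eqs)
    thus ?thesis using \<open>0 < s\<close> by (simp only: if_True)
  qed
  have outer_rate: "H (Suc J) (2 * s + 2) - H J (2 * s + 2) =
      (if s + 1 < k then H J (2 * s + 3) - H (Suc J) (2 * s + 1)
        - (if n dvd Suc J \<and> s = k - 2 then e else 0) else 0)"
  proof (cases "s + 1 < k")
    case True
    thus ?thesis using even_rule[of s J] by simp
  next
    case False
    hence "2 * s + 2 = 2 * k" using s by simp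
    thus ?thesis using False outer[of J] outer[of "Suc J"] by simp
  qed
  have time: "X s (T + 2) - X s (T + 1) + (X s T - X s (T + 1)) =
      (H (Suc (Suc J)) (2 * s) - H (Suc J) (2 * s)) - (H (Suc J) (2 * s + 2) - H J (2 * s + 2))"
    unfolding X using odd_rule[OF s, of "Suc J"] odd_rule[OF s, of J] by simp
  have lap: "cylinder_laplacian k X s T =
    (if n dvd Suc J \<and> s = k - 2 \<and> s + 1 < k then e else 0)
    - (if n dvd Suc (Suc J) \<and> s = k - 1 \<and> 0 < s then e else 0)"
    unfolding cylinder_laplacian_def time inner_rate outer_rate
    unfolding X(2) up using down by (cases "0 < s"; cases "s + 1 < k") simp_all
  consider "s = k - 1" | "s = k - 2" | "s \<noteq> k - 1" "s \<noteq> k - 2" by blast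
  thus ?thesis
  proof cases
    case 1
    hence "Suc (Suc J) = Suc T + 2" using k2 by (simp add: J_def)
    thus ?thesis unfolding lap using 1 k2 by auto
  next
    case 2
    hence "Suc J = Suc T + 2" using k2 by (simp add: J_def)
    thus ?thesis unfolding lap using 2 k2 by auto
  next
    case 3
    thus ?thesis unfolding lap by auto
  qed
qed

text \<open>
  Multiplying by \<open>n\<close> and adding \<open>t T\<close> cancels the drift without leaving the integers. The added term
  takes the same value on both ends of the dipole edge, so the difference there remains divisible by \<open>n\<close>.
\<close>

lemma no_unit_dipole: "e \<noteq> 1"
proof
  assume e: "e = 1"
  define \<Phi> where "\<Phi> s T = int n * X s T + t * int T" for s T
  interpret periodic_cylinder k n \<Phi>
  proof
    show "\<Phi> s (T + n) = \<Phi> s T" if "s < k" for s T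
      unfolding \<Phi>_def X_shift[OF that] by (simp add: algebra_simps)
  qed (use k2 n2 in auto)
  have lap: "cylinder_laplacian k \<Phi> s T = int n * cylinder_laplacian k X s T" for s T
    by (simp add: cylinder_laplacian_def \<Phi>_def algebra_simps)
  show False
  proof (rule no_integral_dipole[of "int n" 2])
    fix s T assume "s < k"
    thus "cylinder_laplacian k \<Phi> s T = (if n dvd Suc T + 2
        then int n * ((if s = k - 2 then 1 else 0) - (if s = k - 1 then 1 else 0)) else 0)"
      unfolding lap laplacian_X[OF \<open>s < k\<close>] e by simp
  next
    fix T show "int n dvd \<Phi> (k - 1) T - \<Phi> (k - 2) T" by (simp add: \<Phi>_def)
  qed (use k2 n2 in auto)
qed

text \<open>
  The odd faces are harmonic and periodic, hence constant. Then neighbouring even faces have equal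
  values, and all of these equal the value \<open>0\<close> of face \<open>0\<close>.
\<close>

lemma periodic_faces_trivial:
  assumes e: "e = 0" and t: "t = 0" and H1: "H 0 1 = 0" and i: "i \<le> 2 * k"
  shows "H 0 i = 0"
proof -
  interpret periodic_cylinder k n X
    by unfold_locales (use k2 n2 X_shift t in auto)
  obtain M where M: "\<And>s T. s < k \<Longrightarrow> X s T = M"
  proof (rule harmonic_constant)
    show "cylinder_laplacian k X s T = 0" if "s < k" for s T
      unfolding laplacian_X[OF that] e by simp
  qed blast
  have many: "H (j + a * n) (2 * s + 1) = H j (2 * s + 1)" if "s < k" for j a s
  proof (induction a)
    case (Suc a)
    thus ?case using shift[OF that, of "j + a * n"] t by (simp add: algebra_simps)
  qed simp
  have const: "H j (2 * s + 1) = M" if s: "s < k" for j s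
  proof -
    have "k \<le> k * n" using n2 by simp
    hence "j + k * n - k + s + k - s = j + k * n" using s by linarith
    hence "X s (j + k * n - k + s) = H (j + k * n) (2 * s + 1)" by (simp add: X_def)
    thus ?thesis using M[OF s] many[OF s] by simp
  qed
  have M0: "M = 0" using const[of 0 0] H1 k2 by simp
  have ev: "\<forall>j. H j (2 * s) = 0" if "s \<le> k" for s
    using that
  proof (induction s)
    case 0 thus ?case by (simp add: inner)
  next
    case (Suc s)
    show ?case
    proof
      fix j show "H j (2 * Suc s) = 0"
        using Suc odd_rule[of s j] const[of s j] const[of s "Suc j"] by simp
    qed
  qed
  show ?thesis
  proof (cases "even i")
    case True
    thus ?thesis using ev i by (auto elim!: evenE)
  next
    case False
    then obtain s where "i = 2 * s + 1" by (auto elim: oddE)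
    thus ?thesis using const[of s 0] i M0 by simp
  qed
qed

end

text \<open>
  The jump \<open>e\<close> at the faces \<open>2 k - 2\<close> and \<open>2 k - 1\<close> is exactly the effect of a defect at face \<open>2 k - 2\<close> in
  the last block: the following move at face \<open>2 k - 1\<close> passes it on, and the constant face \<open>2 k\<close> stops
  it. Removing the jump therefore violates just one rule per turn.
\<close>

lemma face_levels_of_closing:
  assumes k: "k \<ge> 2" and n: "n \<ge> 2" and P0: "P 0 = 0"
    and closing: "\<And>i. i \<le> 2 * k \<Longrightarrow> level (2 * k) n P i = P i - (if odd i then t else 0)
      + (if i = 2 * k - 1 \<or> i = 2 * k - 2 then e else 0)"
  shows "face_levels k n (\<lambda>j i. level (2 * k) (j mod n) P i - (if odd i then t * int (j div n) else 0)) t e"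
proof
  let ?Q = "\<lambda>j. level (2 * k) j P"
  have wrap: "n dvd Suc j \<longleftrightarrow> Suc (j mod n) = n" for j
    by (simp add: dvd_eq_mod_eq_0 mod_Suc)
  have nowrap: "Suc j mod n = Suc (j mod n)" "Suc j div n = j div n" if "Suc (j mod n) \<noteq> n" for j
    using that by (simp_all add: mod_Suc div_Suc)
  have wrapped: "Suc j mod n = 0" "Suc j div n = Suc (j div n)" if "Suc (j mod n) = n" for j
    using that by (simp_all add: mod_Suc div_Suc)
  show "k \<ge> 2" "n \<ge> 2" by fact+
  show "?Q (j mod n) 0 - (if odd (0::nat) then t * int (j div n) else 0) = 0" for j
    using P0 by (simp add: level_end)
  show "?Q (j mod n) (2 * k) - (if odd (2 * k) then t * int (j div n) else 0) =
      ?Q (0 mod n) (2 * k) - (if odd (2 * k) then t * int (0 div n) else 0)" for j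
    by (simp add: level_end)
  show "?Q ((j + n) mod n) (2 * s + 1) - (if odd (2 * s + 1) then t * int ((j + n) div n) else 0) =
      ?Q (j mod n) (2 * s + 1) - (if odd (2 * s + 1) then t * int (j div n) else 0) - t" for s j
    using n by (simp add: algebra_simps)
  show "?Q (Suc j mod n) (2 * s + 1) - (if odd (2 * s + 1) then t * int (Suc j div n) else 0) =
      ?Q (j mod n) (2 * s + 1) - (if odd (2 * s + 1) then t * int (j div n) else 0)
      + (?Q (Suc j mod n) (2 * s) - (if odd (2 * s) then t * int (Suc j div n) else 0))
      - (?Q (j mod n) (2 * s + 2) - (if odd (2 * s + 2) then t * int (j div n) else 0))"
    if s: "s < k" for s j
  proof (cases "Suc (j mod n) = n")
    case False
    show ?thesis using level_odd[of "2 * s + 1" "2 * k" "j mod n" P] s by (simp add: nowrap[OF False])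
  next
    case True
    have "?Q n (2 * s + 1) = ?Q (j mod n) (2 * s + 1) + ?Q n (2 * s) - ?Q (j mod n) (2 * s + 2)"
      using level_odd[of "2 * s + 1" "2 * k" "j mod n" P] s True by simp
    moreover have "2 * s + 1 = 2 * k - 1 \<or> 2 * s + 1 = 2 * k - 2 \<longleftrightarrow> s = k - 1"
      "2 * s = 2 * k - 1 \<or> 2 * s = 2 * k - 2 \<longleftrightarrow> s = k - 1" using s by presburger+
    ultimately show ?thesis using closing[of "2 * s + 1"] closing[of "2 * s"] s
      by (simp add: wrapped[OF True] algebra_simps split: if_splits)
  qed
  show "?Q (Suc j mod n) (2 * s + 2) - (if odd (2 * s + 2) then t * int (Suc j div n) else 0) =
      ?Q (j mod n) (2 * s + 2) - (if odd (2 * s + 2) then t * int (j div n) else 0)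
      - (?Q (Suc j mod n) (2 * s + 1) - (if odd (2 * s + 1) then t * int (Suc j div n) else 0))
      + (?Q (j mod n) (2 * s + 3) - (if odd (2 * s + 3) then t * int (j div n) else 0))
      - (if n dvd Suc j \<and> s = k - 2 then e else 0)"
    if s: "Suc s < k" for s j
  proof (cases "Suc (j mod n) = n")
    case False
    show ?thesis using level_even[of "2 * s + 2" "2 * k" "j mod n" P] s False
      by (simp add: nowrap[OF False] wrap numeral_3_eq_3)
  next
    case True
    have "?Q n (2 * s + 2) = ?Q (j mod n) (2 * s + 2) - ?Q n (2 * s + 1) + ?Q (j mod n) (2 * s + 3)"
      using level_even[of "2 * s + 2" "2 * k" "j mod n" P] s True by (simp add: numeral_3_eq_3)
    moreover have "\<not> (2 * s + 1 = 2 * k - 1 \<or> 2 * s + 1 = 2 * k - 2)"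
      "2 * s + 2 = 2 * k - 1 \<or> 2 * s + 2 = 2 * k - 2 \<longleftrightarrow> s = k - 2" using s by presburger+
    ultimately show ?thesis using closing[of "2 * s + 1"] closing[of "2 * s + 2"] s True
      by (simp add: wrapped[OF True] wrap algebra_simps split: if_splits)
  qed
qed

section \<open>Even numbers of strands\<close>

text \<open>
  The closing conditions prescribe sums of jumps at adjacent faces. Since the last face has no jump,
  they determine all jumps downwards from it.
\<close>

lemma face_levels_of_solution:
  assumes k: "k \<ge> 2" and n: "n \<ge> 2"
    and P0: "P 0 = 0"
    and D: "\<And>i. D i = (if i = 2 * k - 1 \<or> i = 2 * k - 2 then e else 0) - (if odd i then t else 0)"
    and sol: "\<And>i. 0 < i \<Longrightarrow> i < 2 * k \<Longrightarrow>
      (level (2 * k) n P i + level (2 * k) n P (Suc i)) - (P i + P (Suc i)) = D i + D (Suc i)"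
  shows "face_levels k n (\<lambda>j i. level (2 * k) (j mod n) P i - (if odd i then t * int (j div n) else 0)) t e"
proof (rule face_levels_of_closing[where P = P, OF k n P0])
  fix i assume i: "i \<le> 2 * k"
  have D_ends: "D 0 = 0" "D (2 * k) = 0" using k by (auto simp: D)
  have "level (2 * k) n P i = P i + D i"
  proof (cases "i = 0")
    case True
    thus ?thesis using D_ends by (simp add: level_end)
  next
    case False
    from i have "0 < i \<longrightarrow> level (2 * k) n P i = P i + D i"
    proof (induction i rule: inc_induct)
      case base
      show ?case using D_ends by (simp add: level_end)
    next
      case (step i)
      show ?case using step sol[of i] by auto
    qed
    thus ?thesis using False by simp
  qed
  thus "level (2 * k) n P i = P i - (if odd i then t else 0)
      + (if i = 2 * k - 1 \<or> i = 2 * k - 2 then e else 0)" by (simp add: D)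
qed

lemma closing_vec_zero [simp]: "closing_vec m N (\<lambda>_. 0) = 0\<^sub>v N"
  by (auto simp: closing_vec_def)

lemma closing_vec_carrier [simp]: "closing_vec m N z \<in> carrier_vec N"
  by (simp add: closing_vec_def)

lemma det_even_nonzero:
  assumes k: "k \<ge> 2" and n: "n \<ge> 2"
  shows "det (reduced_matrix (2 * k) (turks_head_braid (2 * k) n)) \<noteq> 0"
proof
  let ?m = "2 * k" and ?w = "turks_head_braid (2 * k) n"
  let ?N = "?m + length ?w - 1"
  assume "det (reduced_matrix ?m ?w) = 0"
  then obtain y where y: "y \<in> carrier_vec ?N" "y \<noteq> 0\<^sub>v ?N" "reduced_matrix ?m ?w *\<^sub>v y = 0\<^sub>v ?N"
    using det_0_iff_vec_prod_zero[OF reduced_matrix_carrier] by blast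
  have m: "?m > 0" using k by simp
  obtain P where P: "P 0 = 0" "P 1 = 0"
    "\<And>i. 0 < i \<Longrightarrow> i < ?m \<Longrightarrow> (level ?m n P i + level ?m n P (Suc i)) - (P i + P (Suc i)) = 0"
    "(\<And>i. i < ?m \<Longrightarrow> P i + P (Suc i) = 0) \<Longrightarrow> y = 0\<^sub>v ?N"
    using faces_of_solution[OF valid_turks_head m y(1), of "\<lambda>_. 0"] y(3)
    unfolding fold_turks_head closing_vec_zero by metis
  interpret face_levels k n "\<lambda>j i. level ?m (j mod n) P i - (if odd i then 0 * int (j div n) else 0)" 0 0
    by (rule face_levels_of_solution[where D = "\<lambda>_. 0" and P = P, OF k n P(1)]) (use P(3) in auto)
  have "P i = 0" if "i \<le> ?m" for i
    using periodic_faces_trivial[OF refl refl _ that] P(2) by simp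
  hence "y = 0\<^sub>v ?N" by (intro P(4)) auto
  thus False using y(2) by simp
qed

text \<open>
  The potential of the unit drift around the cylinder: a sweep adds \<open>1\<close> to every odd face
  and keeps the even faces. Its colours are alternately \<open>0\<close> and \<open>- 1\<close>, so they give a colouring
  modulo \<open>n\<close> with a unit entry.
\<close>

definition staircase :: "nat \<Rightarrow> int" where
  "staircase i = (if odd i then int (i div 2) else - int (i div 2))"

lemma staircase_simps:
  "staircase (2 * s) = - int s" "staircase (Suc (2 * s)) = int s"
  "staircase (Suc (Suc (2 * s))) = - int s - 1" "staircase (Suc (Suc (Suc (2 * s)))) = int s + 1"
  by (simp_all add: staircase_def)

lemma staircase_level:
  assumes "i \<le> 2 * k"
  shows "level (2 * k) j staircase i = staircase i + (if odd i then int j else 0)"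
  using assms
proof (induction j arbitrary: i)
  case (Suc j)
  note IH = Suc.IH
  show ?case using Suc.prems
  proof (induction i)
    case 0
    show ?case by (simp add: level_end staircase_def)
  next
    case (Suc i)
    consider "Suc i = 2 * k" | "Suc i < 2 * k" "odd (Suc i)" | "Suc i < 2 * k" "even (Suc i)"
      using Suc.prems by linarith
    thus ?case
    proof cases
      case 1
      hence "even (Suc i)" by simp
      thus ?thesis using 1 by (simp add: level_end)
    next
      case 2
      then obtain s where s: "i = 2 * s" by auto
      have "level (2 * k) (Suc j) staircase (Suc i)
          = (staircase (Suc i) + int j) + staircase i - staircase (Suc (Suc i))"
        using level_odd[OF 2(2,1), of j staircase] Suc.IH IH[of "Suc i"] IH[of "Suc (Suc i)"] 2 by simp
      thus ?thesis using 2 by (simp add: s staircase_simps)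
    next
      case 3
      then obtain s where s: "i = 2 * s + 1" by (auto elim!: oddE)
      have "level (2 * k) (Suc j) staircase (Suc i)
          = staircase (Suc i) - (staircase i + int (Suc j)) + (staircase (Suc (Suc i)) + int j)"
        using level_even[OF 3(2) _ 3(1), of j staircase] Suc.IH IH[of "Suc i"] IH[of "Suc (Suc i)"] 3
        by simp
      thus ?thesis using 3 by (simp add: s staircase_simps)
    qed
  qed
qed simp

lemma closing_vec_smult: "closing_vec m N (\<lambda>i. c * z i) = c \<cdot>\<^sub>v closing_vec m N z"
  by (auto simp: closing_vec_def)

lemma closing_vec_cong:
  assumes "\<And>i. 0 < i \<Longrightarrow> i < m \<Longrightarrow> z i = z' i"
  shows "closing_vec m N z = closing_vec m N z'"
  using assms by (auto simp: closing_vec_def)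

lemma staircase_colouring:
  assumes k: "k \<ge> 2" and N: "N = 2 * k + length (turks_head_braid (2 * k) n) - 1"
  obtains v where "v \<in> carrier_vec N" "v $ 0 = - 1"
    "reduced_matrix (2 * k) (turks_head_braid (2 * k) n) *\<^sub>v v
      = int n \<cdot>\<^sub>v closing_vec (2 * k) N (\<lambda>_. 1)"
proof -
  have "staircase 0 + staircase 1 = 0" by (simp add: staircase_def)
  from colouring_of_faces[OF valid_turks_head _ this, of "2 * k" n] k
  obtain u where u: "\<And>i. i < 2 * k \<Longrightarrow> u i = staircase i + staircase (Suc i)"
    "reduced_matrix (2 * k) (turks_head_braid (2 * k) n) *\<^sub>v colour_vec N u = closing_vec (2 * k) N
      (\<lambda>i. (level (2 * k) n staircase i + level (2 * k) n staircase (Suc i)) - (staircase i + staircase (Suc i)))"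
    unfolding fold_turks_head N by auto
  have "closing_vec (2 * k) N
      (\<lambda>i. (level (2 * k) n staircase i + level (2 * k) n staircase (Suc i)) - (staircase i + staircase (Suc i)))
      = closing_vec (2 * k) N (\<lambda>i. int n * 1)"
    by (rule closing_vec_cong) (simp add: staircase_level)
  hence "reduced_matrix (2 * k) (turks_head_braid (2 * k) n) *\<^sub>v colour_vec N u
      = int n \<cdot>\<^sub>v closing_vec (2 * k) N (\<lambda>_. 1)"
    using u(2) closing_vec_smult[of "2 * k" N "int n" "\<lambda>_. 1"] by simp
  moreover have "colour_vec N u $ 0 = - 1"
    using u(1)[of 1] k N by (simp add: colour_vec_def staircase_def)
  moreover have "colour_vec N u \<in> carrier_vec N" by (simp add: colour_vec_def)
  ultimately show ?thesis using that by blast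
qed

text \<open>
  Otherwise the closing condition of a unit jump at the faces \<open>2 k - 2\<close> and \<open>2 k - 1\<close> would be solvable
  over the integers, up to a multiple \<open>t\<close> of the closing condition of the staircase, and the solution
  would be a unit dipole.
\<close>

lemma abs_det_even_neq_length:
  assumes k: "k \<ge> 2" and n: "n \<ge> 2"
  shows "\<bar>det (reduced_matrix (2 * k) (turks_head_braid (2 * k) n))\<bar> \<noteq> int n"
proof
  let ?m = "2 * k" and ?w = "turks_head_braid (2 * k) n"
  define N where "N = ?m + length ?w - 1"
  let ?A = "reduced_matrix ?m ?w"
  have A: "?A \<in> carrier_mat N N" unfolding N_def by (rule reduced_matrix_carrier)
  have N0: "0 < N" using k by (simp add: N_def)
  assume d: "\<bar>det ?A\<bar> = int n"
  define D where "D t i = (if i = 2 * k - 1 \<or> i = 2 * k - 2 then 1 else 0) - (if odd i then t else 0)"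
    for t :: int and i
  obtain v where v: "v \<in> carrier_vec N" "v $ 0 = - 1"
    "?A *\<^sub>v v = int n \<cdot>\<^sub>v closing_vec ?m N (\<lambda>_. 1)"
    using staircase_colouring[OF k N_def] by blast
  have "\<bar>v $ 0\<bar> = 1" "int n > 0" using v(2) n by simp_all
  from solvable_of_abs_det_eq[OF A v(1) N0 closing_vec_carrier v(3) this d closing_vec_carrier]
  obtain y t where y: "y \<in> carrier_vec N"
    "?A *\<^sub>v y + t \<cdot>\<^sub>v closing_vec ?m N (\<lambda>_. 1) = closing_vec ?m N (\<lambda>i. D 0 i + D 0 (Suc i))"
    by blast
  have "?A *\<^sub>v y = closing_vec ?m N (\<lambda>i. D t i + D t (Suc i))"
  proof (rule eq_vecI)
    fix r assume "r < dim_vec (closing_vec ?m N (\<lambda>i. D t i + D t (Suc i)))"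
    hence r: "r < N" by (simp add: closing_vec_def)
    have Ay: "?A *\<^sub>v y \<in> carrier_vec N" using A y(1) by simp
    have "(?A *\<^sub>v y) $ r + t * (if Suc r < ?m then 1 else 0)
        = (if Suc r < ?m then D 0 (Suc r) + D 0 (Suc (Suc r)) else 0)"
      using arg_cong[OF y(2), of "\<lambda>x. x $ r"] r Ay by (simp add: closing_vec_def)
    thus "(?A *\<^sub>v y) $ r = closing_vec ?m N (\<lambda>i. D t i + D t (Suc i)) $ r"
      using r by (auto simp: closing_vec_def D_def)
  qed (use A y(1) in \<open>auto simp: closing_vec_def\<close>)
  from faces_of_solution[OF valid_turks_head _ y(1)[unfolded N_def] this[unfolded N_def]] k
  obtain P where P: "P 0 = 0" "\<And>i. 0 < i \<Longrightarrow> i < ?m \<Longrightarrow>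
      (level ?m n P i + level ?m n P (Suc i)) - (P i + P (Suc i)) = D t i + D t (Suc i)"
    unfolding fold_turks_head by auto
  interpret face_levels k n "\<lambda>j i. level ?m (j mod n) P i - (if odd i then t * int (j div n) else 0)" t 1
    by (rule face_levels_of_solution[where D = "D t" and P = P, OF k n P(1)]) (use P(2) in \<open>auto simp: D_def\<close>)
  show False using no_unit_dipole by simp
qed

lemma compositeI: "k = a * b \<Longrightarrow> 1 < a \<Longrightarrow> 1 < b \<Longrightarrow> composite k"
  using prime_product[of a b] less_1_mult[of a b] by (auto simp: composite_def)

lemma thk_determinant_eq:
  "int (thk_determinant m n) = \<bar>det (reduced_matrix m (turks_head_braid m n))\<bar>"
  by (simp add: thk_determinant_def closure_determinant_eq)

lemma composite_even:
  assumes k: "k \<ge> 2" and n: "n \<ge> 2"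
  shows "composite (thk_determinant (2 * k) n)"
proof -
  let ?A = "reduced_matrix (2 * k) (turks_head_braid (2 * k) n)" and ?d = "thk_determinant (2 * k) n"
  define N where "N = 2 * k + length (turks_head_braid (2 * k) n) - 1"
  have A: "?A \<in> carrier_mat N N" unfolding N_def by (rule reduced_matrix_carrier)
  have N0: "0 < N" using k by (simp add: N_def)
  obtain v where v: "v \<in> carrier_vec N" "v $ 0 = - 1"
    "?A *\<^sub>v v = int n \<cdot>\<^sub>v closing_vec (2 * k) N (\<lambda>_. 1)"
    using staircase_colouring[OF k N_def] by blast
  have "int n dvd det ?A"
    by (rule dvd_det_if_kernel_mod[OF A v(1) N0 closing_vec_carrier v(3)]) (use v(2) in simp)
  hence "int n dvd int ?d" by (simp add: thk_determinant_eq)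
  then obtain r where r: "?d = n * r" unfolding of_nat_dvd_iff by (rule dvdE)
  have "?d \<noteq> 0" using det_even_nonzero[OF k n] thk_determinant_eq[of "2 * k" n] by auto
  moreover have "?d \<noteq> n" using abs_det_even_neq_length[OF k n] thk_determinant_eq[of "2 * k" n] by auto
  ultimately have "r \<noteq> 0" "r \<noteq> 1" using r by auto
  thus ?thesis using compositeI[OF r] n by simp
qed

section \<open>Three strands\<close>

text \<open>
  In the coordinates \<open>P 1 - P 3\<close> and \<open>P 2\<close> a sweep is the matrix with rows \<open>(1, - 1)\<close> and \<open>(- 1, 2)\<close>,
  whose powers consist of Fibonacci numbers.
\<close>

lemma level_three:
  assumes "P 0 = 0"
  shows "level 3 j P 1 = P 3 + (int (fib (2 * j + 1)) - int (fib (2 * j))) * (P 1 - P 3) - int (fib (2 * j)) * P 2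
    \<and> level 3 j P 2 = int (fib (2 * j + 1)) * P 2 - int (fib (2 * j)) * (P 1 - P 3)"
proof (induction j)
  case (Suc j)
  have f: "fib (2 * Suc j) = fib (2 * j + 1) + fib (2 * j)"
    "fib (2 * Suc j + 1) = 2 * fib (2 * j + 1) + fib (2 * j)"
    by (simp_all add: numeral_2_eq_2)
  have 1: "level 3 (Suc j) P 1 = level 3 j P 1 - level 3 j P 2"
    using level_odd[of 1 3 j P] assms by (simp add: level_end numeral_2_eq_2)
  have 2: "level 3 (Suc j) P 2 = level 3 j P 2 - level 3 (Suc j) P 1 + P 3"
    using level_even[of 2 3 j P] by (simp add: level_end numeral_3_eq_3)
  show ?case unfolding 2 unfolding 1 f using Suc by (simp add: algebra_simps)
qed simp

lemma fib_double_int: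
  "int (fib (2 * n)) = int (fib n) * (2 * int (fib (Suc n)) - int (fib n)) \<and>
   int (fib (2 * n + 1)) = (int (fib n))\<^sup>2 + (int (fib (Suc n)))\<^sup>2 \<and>
   (int (fib (Suc n)))\<^sup>2 - int (fib (Suc n)) * int (fib n) - (int (fib n))\<^sup>2 = (- 1) ^ n"
proof (induction n)
  case (Suc n)
  have f: "fib (2 * Suc n) = fib (2 * n + 1) + fib (2 * n)"
    "fib (2 * Suc n + 1) = 2 * fib (2 * n + 1) + fib (2 * n)"
    by (simp_all add: numeral_2_eq_2)
  show ?case unfolding f using Suc by (simp add: algebra_simps power2_eq_square)
qed simp

text \<open>
  With \<open>g\<close> the golden ratio and \<open>h\<close> its conjugate, \<open>g\<^bsup>2n\<^esup> - 1 = g\<^sup>n (g\<^sup>n - (- 1)\<^sup>n h\<^sup>n)\<close>. The second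
  factor is the Lucas number for odd \<open>n\<close> and \<open>sqrt 5\<close> times the Fibonacci number for even \<open>n\<close>. The proof
  takes the factor from the doubling formulas and Cassini's identity instead.
\<close>

lemma common_fib_divisor:
  assumes "n \<ge> 3"
  obtains q :: int where "q \<ge> 2" "q dvd int (fib (2 * n))" "q dvd int (fib (2 * n + 1)) - 1"
proof -
  define a b where "a = int (fib n)" and "b = int (fib (Suc n))"
  have "fib 3 \<le> fib n" using assms by (rule fib_mono)
  hence a2: "a \<ge> 2" by (simp add: a_def numeral_3_eq_3)
  have ab: "a \<le> b" using fib_Suc_mono by (simp add: a_def b_def)
  note dbl = fib_double_int[of n, folded a_def b_def]
  show ?thesis
  proof (cases "even n")
    case True
    hence "b\<^sup>2 - b * a - a\<^sup>2 = 1" using dbl by simp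
    hence "a\<^sup>2 + b\<^sup>2 - 1 = a * (b + 2 * a)" by (simp add: algebra_simps power2_eq_square)
    thus ?thesis using that[of a] a2 dbl by simp
  next
    case False
    hence "b\<^sup>2 - b * a - a\<^sup>2 = - 1" using dbl by simp
    hence "a\<^sup>2 + b\<^sup>2 - 1 = (2 * b - a) * b" by (simp add: algebra_simps power2_eq_square)
    \<comment> \<open>\<open>2 b - a\<close> is the Lucas number \<open>L\<^sub>n\<close>.\<close>
    thus ?thesis using that[of "2 * b - a"] a2 ab dbl by simp
  qed
qed

text \<open>
  A potential reproduced after \<open>n\<close> sweeps is fixed by the \<open>n\<close>-th power of the matrix, and the
  determinant of this power minus the identity is \<open>2 - 2 F\<^bsub>2n+1\<^esub> + F\<^bsub>2n\<^esub> = 2 - L\<^bsub>2n\<^esub>\<close>, which is negative.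
\<close>

lemma det_three_nonzero:
  assumes n: "n \<ge> 3"
  shows "det (reduced_matrix 3 (turks_head_braid 3 n)) \<noteq> 0"
proof
  let ?w = "turks_head_braid 3 n"
  let ?N = "3 + length ?w - 1"
  assume "det (reduced_matrix 3 ?w) = 0"
  then obtain y where y: "y \<in> carrier_vec ?N" "y \<noteq> 0\<^sub>v ?N" "reduced_matrix 3 ?w *\<^sub>v y = 0\<^sub>v ?N"
    using det_0_iff_vec_prod_zero[OF reduced_matrix_carrier] by blast
  obtain P where P: "P 0 = 0" "P 1 = 0"
    "\<And>i. 0 < i \<Longrightarrow> i < 3 \<Longrightarrow> (level 3 n P i + level 3 n P (Suc i)) - (P i + P (Suc i)) = 0"
    "(\<And>i. i < 3 \<Longrightarrow> P i + P (Suc i) = 0) \<Longrightarrow> y = 0\<^sub>v ?N"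
    using faces_of_solution[OF valid_turks_head _ y(1), of "\<lambda>_. 0"] y(3)
    unfolding fold_turks_head closing_vec_zero by (metis zero_less_numeral)
  define f g where "f = int (fib (2 * n))" and "g = int (fib (2 * n + 1))"
  define x where "x = P 1 - P 3"
  have "level 3 n P 2 = P 2" using P(3)[of 2] by (simp add: level_end numeral_3_eq_3)
  moreover from this have "level 3 n P 1 = P 1" using P(3)[of 1] by (simp add: numeral_2_eq_2)
  ultimately have e1: "(g - f - 1) * x = f * P 2" and e2: "(g - 1) * P 2 = f * x"
    using level_three[where P = P and j = n, OF P(1)] unfolding f_def[symmetric] g_def[symmetric]
    by (simp_all add: x_def algebra_simps)
  have cassini: "g\<^sup>2 - g * f - f\<^sup>2 = 1" using fib_double_int[of "2 * n"] by (simp add: f_def g_def)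
  have "fib 6 \<le> fib (2 * n)" using n by (intro fib_mono) simp
  hence f8: "f \<ge> 8" by (simp add: f_def numeral_eq_Suc)
  have gf: "g \<ge> f" using fib_Suc_mono[of "2 * n"] by (simp add: f_def g_def)
  have "(2 - 2 * g + f) * x = (g\<^sup>2 - g * f - f\<^sup>2 + 1 - 2 * g + f) * x" unfolding cassini by simp
  also have "\<dots> = (g - 1) * ((g - f - 1) * x) - f * (f * x)" by (simp add: algebra_simps power2_eq_square)
  also have "\<dots> = 0" unfolding e1 e2[symmetric] by simp
  finally have x0: "x = 0" using f8 gf by auto
  hence "P 2 = 0" using e1 f8 by simp
  moreover have "P 3 = 0" using x0 P(2) by (simp add: x_def)
  ultimately have "P i + P (Suc i) = 0" if "i < 3" for i
    using that P(1,2) by (auto simp: less_Suc_eq numeral_3_eq_3 numeral_2_eq_2)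
  thus False using P(4) y(2) by blast
qed

text \<open>
  Any two colours at positions \<open>1\<close> and \<open>2\<close> extend to a colouring modulo \<open>q\<close>, because \<open>n\<close> sweeps fix
  every potential modulo \<open>q\<close>.
\<close>

lemma three_strand_colouring:
  assumes q: "q dvd int (fib (2 * n))" "q dvd int (fib (2 * n + 1)) - 1"
    and N: "N = 3 + length (turks_head_braid 3 n) - 1"
  obtains v b where "v \<in> carrier_vec N" "b \<in> carrier_vec N" "v $ 0 = c" "v $ 1 = c'"
    "reduced_matrix 3 (turks_head_braid 3 n) *\<^sub>v v = q \<cdot>\<^sub>v b"
proof -
  define P where "P i = (if i = 2 then c else if i = 3 then c' - c else 0)" for i :: nat
  define z where "z i = (level 3 n P i + level 3 n P (Suc i)) - (P i + P (Suc i))" for i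
  have P: "P 0 = 0" "P 0 + P 1 = 0" by (simp_all add: P_def)
  obtain u where u: "\<And>i. i < 3 \<Longrightarrow> u i = P i + P (Suc i)"
    "reduced_matrix 3 (turks_head_braid 3 n) *\<^sub>v colour_vec N u = closing_vec 3 N z"
    using colouring_of_faces[OF valid_turks_head _ P(2), of 3 n]
    unfolding fold_turks_head N z_def by auto
  obtain f g where fg: "int (fib (2 * n)) = q * f" "int (fib (2 * n + 1)) = 1 + q * g"
    using q by (metis add.commute diff_add_cancel dvdE)
  have lev: "level 3 n P 1 - P 1 = q * ((g - f) * (P 1 - P 3) - f * P 2)"
    "level 3 n P 2 - P 2 = q * (g * P 2 - f * (P 1 - P 3))"
    using level_three[where P = P and j = n, OF P(1)] unfolding fg by (simp_all add: algebra_simps)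
  have "q dvd z i" if "0 < i" "i < 3" for i
  proof -
    have "i = 1 \<or> i = 2" using that by linarith
    moreover have "z 1 = (level 3 n P 1 - P 1) + (level 3 n P 2 - P 2)"
      by (simp add: z_def numeral_2_eq_2)
    moreover have "z 2 = level 3 n P 2 - P 2" by (simp add: z_def level_end)
    ultimately show ?thesis unfolding lev by fastforce
  qed
  hence "closing_vec 3 N z = closing_vec 3 N (\<lambda>i. q * (z i div q))"
    by (intro closing_vec_cong) simp
  hence "reduced_matrix 3 (turks_head_braid 3 n) *\<^sub>v colour_vec N u
      = q \<cdot>\<^sub>v closing_vec 3 N (\<lambda>i. z i div q)"
    using u(2) closing_vec_smult[of 3 N q "\<lambda>i. z i div q"] by simp
  moreover have "colour_vec N u $ 0 = c" "colour_vec N u $ 1 = c'"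
    using u(1)[of 1] u(1)[of 2] N by (simp_all add: colour_vec_def P_def numeral_2_eq_2)
  moreover have "colour_vec N u \<in> carrier_vec N" by (simp add: colour_vec_def)
  ultimately show ?thesis using that[of "colour_vec N u" "closing_vec 3 N (\<lambda>i. z i div q)"] by simp
qed

lemma composite_three:
  assumes n: "n \<ge> 3"
  shows "composite (thk_determinant 3 n)"
proof -
  let ?A = "reduced_matrix 3 (turks_head_braid 3 n)" and ?d = "thk_determinant 3 n"
  define N where "N = 3 + length (turks_head_braid 3 n) - 1"
  have A: "?A \<in> carrier_mat N N" unfolding N_def by (rule reduced_matrix_carrier)
  have N0: "0 < N" "1 < N" using n by (simp_all add: N_def length_turks_head)
  obtain q :: int where q: "q \<ge> 2" "q dvd int (fib (2 * n))" "q dvd int (fib (2 * n + 1)) - 1"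
    using common_fib_divisor[OF n] by blast
  obtain v b where v: "v \<in> carrier_vec N" "b \<in> carrier_vec N" "v $ 0 = 1" "?A *\<^sub>v v = q \<cdot>\<^sub>v b"
    using three_strand_colouring[OF q(2,3) N_def, of 1 0] by metis
  obtain v' b' where v': "v' \<in> carrier_vec N" "b' \<in> carrier_vec N" "v' $ 0 = 0" "v' $ 1 = 1"
    "?A *\<^sub>v v' = q \<cdot>\<^sub>v b'"
    using three_strand_colouring[OF q(2,3) N_def, of 0 1] by metis
  have "q\<^sup>2 dvd det ?A"
    by (rule square_dvd_det[OF A v(1) v'(1) v(2) v'(2) v(4) v'(5) N0 v(3) v'(3,4)])
  moreover have "q = int (nat q)" using q(1) by simp
  ultimately have "int ((nat q)\<^sup>2) dvd int ?d" by (simp add: thk_determinant_eq)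
  then obtain r where r: "?d = (nat q)\<^sup>2 * r" unfolding of_nat_dvd_iff by (rule dvdE)
  have "?d \<noteq> 0" using det_three_nonzero[OF n] thk_determinant_eq[of 3 n] by auto
  hence "0 < r" using r by (cases r) auto
  have "1 < nat q" using q(1) by simp
  moreover have "1 < nat q * r" using \<open>1 < nat q\<close> \<open>0 < r\<close> by (metis less_le_trans mult_le_mono2 nat_mult_1_right Suc_leI One_nat_def)
  moreover have "?d = nat q * (nat q * r)" using r by (simp add: power2_eq_square)
  ultimately show ?thesis using compositeI by blast
qed

theorem theorem4:
  fixes m n :: nat
  assumes "m \<ge> 3" and "n \<ge> 3" and "coprime m n"
    and "m = 3 \<or> even m"
  shows "composite (thk_determinant m n)"
proof (cases "m = 3")
  case True
  thus ?thesis using composite_three[OF assms(2)] by simp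
next
  case False
  then obtain k where k: "m = 2 * k" using assms(4) by (auto elim: evenE)
  show ?thesis unfolding k using assms(1,2) k by (intro composite_even) auto
qed

end
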